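(* Let the incident wave profile $F\in L^1_{loc}(\mathbb{R})$ satisfy $F(s)=0$ for $s<0$ and $\sup_{s\in\mathbb{R}}(1+|s|)^p|F(s)|<\infty$ for some $p\in\mathbb{R}$. (i) If $F(s)\to C$ as $s\to\infty$, then the diffracted wave converges in the long time limit: $$u_d(\rho,\theta,t)\ \xrightarrow[t\to\infty]{}\ u_d(\theta,\infty):=\frac{iC}{4\Phi}\int_{\mathbb{R}}Z(\beta+i\theta)\,d\beta,\qquad\rho>0,\ \theta\in\Theta,$$ and in particular $$[u_d]_k(\rho,t)\ \xrightarrow[t\to\infty]{}\ C\qquad\text{for } \rho>0,\ k=1,2. \tag{$*$}$$ (ii) Conversely, $( * )$ implies that $F(s)\to C$ as $s\to\infty$.
   Context: Fix $\phi\in(0,\pi)$, $\Phi:=2\pi-\phi$, $q:=\pi/(2\Phi)$, and $\alpha$ with $\max(0,\phi-\pi/2)<\alpha<\min(\pi/2,\phi)$ (standing assumption). Put $\theta_1:=2\phi-\alpha$, $\theta_2:=2\pi-\alpha$, $\Theta:=[\phi,2\pi]\setminus\{\theta_1,\theta_2\}$. Kernel (for diffraction by the wedge $0\le\theta\le\phi$ with boundary conditions of type DD, NN or DN, D = Dirichlet, N = Neumann). $H(\beta)=\coth(q(\beta+\tfrac{i\pi}2-i\alpha))\mp\coth(q(\beta-\tfrac{3i\pi}2+i\alpha))$ for DD (upper sign) and NN (lower sign), $H(\beta)=\dfrac1{\sinh(q(\beta+\frac{i\pi}2-i\alpha))}+\dfrac1{\sinh(q(\beta-\frac{3i\pi}2+i\alpha))}$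 for DN; $Z(\beta)=-H(\beta-\tfrac{i\pi}2)+H(\beta-\tfrac{5i\pi}2)$. Diffracted wave with profile $F$: $u_d(\rho,\theta,t)=\frac{i}{4\Phi}\int_{\mathbb{R}}Z(\beta+i\theta)F(t-\rho\cosh\beta)\,d\beta$, $\rho>0$, $\theta\in\Theta$, $t\in\mathbb{R}$. Jumps on the critical rays $\theta=\theta_k$: $[u_d]_k(\rho,t):=u_d(\rho,\theta_k+0,t)-u_d(\rho,\theta_k-0,t)$, where $u_d(\rho,\theta_k\pm0,t)=\lim_{\epsilon\to0+}u_d(\rho,\theta_k\pm\epsilon,t)$ is the limit in the sense of distributions.
   Formalization: In ( * ) the limit C is replaced by σ_k C, with (σ_1,σ_2) = (-1,1) for DD, (1,-1) for NN, (-1,-1) for DN: with the stated kernel the jump is σ_k F(t-ρ), so ( * ) as printed fails for C≠0. Limits of F and of the jumps are essential (a.e.) limits. *)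

theory Defs
  imports "HOL-Analysis.Analysis"
begin

datatype boundary_type = DD | NN | DN

definition Phi :: "real \<Rightarrow> real" where
  "Phi \<phi> = 2 * pi - \<phi>"

definition wedge_q :: "real \<Rightarrow> real" where
  "wedge_q \<phi> = pi / (2 * Phi \<phi>)"

definition critical_angle :: "real \<Rightarrow> real \<Rightarrow> nat \<Rightarrow> real" where
  "critical_angle \<phi> \<alpha> k = (if k = 1 then 2 * \<phi> - \<alpha> else 2 * pi - \<alpha>)"

definition regular_angles :: "real \<Rightarrow> real \<Rightarrow> real set" where
  "regular_angles \<phi> \<alpha> = {\<phi>..2 * pi} - {critical_angle \<phi> \<alpha> 1, critical_angle \<phi> \<alpha> 2}"

definition ccoth :: "complex \<Rightarrow> complex" where
  "ccoth z = cosh z / sinh z"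

fun kernel_H :: "boundary_type \<Rightarrow> real \<Rightarrow> real \<Rightarrow> complex \<Rightarrow> complex" where
  "kernel_H DD \<phi> \<alpha> \<beta> =
     ccoth (of_real (wedge_q \<phi>) * (\<beta> + \<i> * of_real pi / 2 - \<i> * of_real \<alpha>)) -
     ccoth (of_real (wedge_q \<phi>) * (\<beta> - 3 * \<i> * of_real pi / 2 + \<i> * of_real \<alpha>))"
| "kernel_H NN \<phi> \<alpha> \<beta> =
     ccoth (of_real (wedge_q \<phi>) * (\<beta> + \<i> * of_real pi / 2 - \<i> * of_real \<alpha>)) +
     ccoth (of_real (wedge_q \<phi>) * (\<beta> - 3 * \<i> * of_real pi / 2 + \<i> * of_real \<alpha>))"
| "kernel_H DN \<phi> \<alpha> \<beta> =
     1 / sinh (of_real (wedge_q \<phi>) * (\<beta> + \<i> * of_real pi / 2 - \<i> * of_real \<alpha>)) +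
     1 / sinh (of_real (wedge_q \<phi>) * (\<beta> - 3 * \<i> * of_real pi / 2 + \<i> * of_real \<alpha>))"

definition kernel_Z :: "boundary_type \<Rightarrow> real \<Rightarrow> real \<Rightarrow> complex \<Rightarrow> complex" where
  "kernel_Z b \<phi> \<alpha> \<beta> =
     - kernel_H b \<phi> \<alpha> (\<beta> - \<i> * of_real pi / 2) + kernel_H b \<phi> \<alpha> (\<beta> - 5 * \<i> * of_real pi / 2)"

definition diffracted_wave ::
  "boundary_type \<Rightarrow> real \<Rightarrow> real \<Rightarrow> (real \<Rightarrow> complex) \<Rightarrow> real \<Rightarrow> real \<Rightarrow> real \<Rightarrow> complex" where
  "diffracted_wave b \<phi> \<alpha> F \<rho> \<theta> t =
     \<i> / (4 * of_real (Phi \<phi>)) *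
     (LINT \<beta>|lebesgue. kernel_Z b \<phi> \<alpha> (of_real \<beta> + \<i> * of_real \<theta>) * F (t - \<rho> * cosh \<beta>))"

definition diffracted_wave_limit ::
  "boundary_type \<Rightarrow> real \<Rightarrow> real \<Rightarrow> complex \<Rightarrow> real \<Rightarrow> complex" where
  "diffracted_wave_limit b \<phi> \<alpha> C \<theta> =
     \<i> * C / (4 * of_real (Phi \<phi>)) *
     (LINT \<beta>|lebesgue. kernel_Z b \<phi> \<alpha> (of_real \<beta> + \<i> * of_real \<theta>))"

definition L1_loc :: "(real \<Rightarrow> complex) \<Rightarrow> bool" where
  "L1_loc f \<longleftrightarrow> (\<forall>K. compact K \<longrightarrow> f absolutely_integrable_on K)"

text \<open>
  Elements of the space \<open>L1_loc\<close> are determined only up to null sets. Accordingly their limits at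
  infinity are essential limits: an event holds eventually for the filter below iff, for some \<open>T\<close>,
  it holds at almost every \<open>s \<ge> T\<close>.
\<close>

abbreviation ae_at_top :: "real filter" where
  "ae_at_top \<equiv> inf at_top (ae_filter lebesgue)"

definition test_functions :: "(real \<Rightarrow> complex) set" where
  "test_functions =
     {\<psi>. compact (closure {x. \<psi> x \<noteq> 0}) \<and>
          (\<forall>n x. ((\<lambda>f y. vector_derivative f (at y)) ^^ n) \<psi> differentiable (at x))}"

definition regular_distribution :: "(real \<Rightarrow> complex) \<Rightarrow> (real \<Rightarrow> complex) \<Rightarrow> complex" where
  "regular_distribution f \<psi> = (LINT t|lebesgue. f t * \<psi> t)"

definition distribution_tendsto ::
  "('i \<Rightarrow> real \<Rightarrow> complex) \<Rightarrow> ((real \<Rightarrow> complex) \<Rightarrow> complex) \<Rightarrow> 'i filter \<Rightarrow> bool" where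
  "distribution_tendsto f T A \<longleftrightarrow>
     (\<forall>\<psi>\<in>test_functions. ((\<lambda>i. regular_distribution (f i) \<psi>) \<longlongrightarrow> T \<psi>) A)"

text \<open>
  The traces on the two sides of a critical ray are limits of distributions in the time variable,
  for fixed \<open>\<rho>\<close>; \<open>J\<close> is their difference.
\<close>

definition jump_distribution ::
  "boundary_type \<Rightarrow> real \<Rightarrow> real \<Rightarrow> (real \<Rightarrow> complex) \<Rightarrow> nat \<Rightarrow> real \<Rightarrow>
   ((real \<Rightarrow> complex) \<Rightarrow> complex) \<Rightarrow> bool" where
  "jump_distribution b \<phi> \<alpha> F k \<rho> J \<longleftrightarrow>
     (\<exists>Tplus Tminus.
        distribution_tendsto
          (\<lambda>\<epsilon>. diffracted_wave b \<phi> \<alpha> F \<rho> (critical_angle \<phi> \<alpha> k + \<epsilon>)) Tplus (at_right 0) \<and>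
        distribution_tendsto
          (\<lambda>\<epsilon>. diffracted_wave b \<phi> \<alpha> F \<rho> (critical_angle \<phi> \<alpha> k - \<epsilon>)) Tminus (at_right 0) \<and>
        J = (\<lambda>\<psi>. Tplus \<psi> - Tminus \<psi>))"

text \<open>
  A limit as \<open>t \<rightarrow> \<infinity>\<close> is meaningful for the jump as a locally integrable function of \<open>t\<close>: the jump
  distribution exists, is regular, and its density has the (essential) limit \<open>c\<close>.
\<close>

definition jump_tendsto ::
  "boundary_type \<Rightarrow> real \<Rightarrow> real \<Rightarrow> (real \<Rightarrow> complex) \<Rightarrow> nat \<Rightarrow> real \<Rightarrow> complex \<Rightarrow> bool" where
  "jump_tendsto b \<phi> \<alpha> F k \<rho> c \<longleftrightarrow>
     (\<exists>J g. jump_distribution b \<phi> \<alpha> F k \<rho> J \<and> L1_loc g \<and>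
        (\<forall>\<psi>\<in>test_functions. J \<psi> = regular_distribution g \<psi>) \<and>
        (g \<longlongrightarrow> c) ae_at_top)"

text \<open>
  Near \<open>\<beta> = 0\<close>, \<open>\<theta> = \<theta>\<^sub>k\<close> the kernel \<open>Z(\<beta> + i\<theta>)\<close> behaves like
  \<open>\<sigma> / (q (\<beta> + i(\<theta> - \<theta>\<^sub>k)))\<close>, where the sign \<open>\<sigma>\<close> depends on the boundary conditions and on \<open>k\<close>;
  by the Sokhotski--Plemelj formula the jump is \<open>\<sigma> F(t - \<rho>)\<close>. At \<open>k = 1\<close> the sign is the
  reflection coefficient of the side \<open>\<theta> = \<phi>\<close> (\<open>-1\<close> for D, \<open>+1\<close> for N), at \<open>k = 2\<close> it is minus that
  of the side \<open>\<theta> = 2\<pi>\<close>; for \<open>DN\<close> the kernel above has D at \<open>\<theta> = \<phi>\<close> and N at \<open>\<theta> = 2\<pi>\<close>.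
\<close>

definition jump_sign :: "boundary_type \<Rightarrow> nat \<Rightarrow> complex" where
  "jump_sign b k =
     (case b of DD \<Rightarrow> (if k = 1 then - 1 else 1)
              | NN \<Rightarrow> (if k = 1 then 1 else - 1)
              | DN \<Rightarrow> - 1)"

end

theory Submission
  imports Defs "HOL-Probability.Sinc_Integral"
begin

text \<open>
  The four hyperbolic functions in \<open>Z(\<beta> + i\<theta>)\<close> are translates, in the angle, of one kernel with a simple
  pole, and \<open>Z\<close> decays exponentially in \<open>\<beta>\<close>. Away from the critical rays the long time limit is
  therefore dominated convergence. Tested in time against \<open>\<psi>\<close>, the wave becomes \<open>\<integral> Z(\<beta> + i\<theta>) K(\<beta>) d\<beta>\<close>, where
  \<open>K(\<beta>) = \<integral> F(t - \<rho> cosh \<beta>) \<psi>(t) dt\<close> is continuous, even, and compactly supported because \<open>F\<close> is causal. As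
  \<open>\<theta>\<close> approaches \<open>\<theta>\<^sub>k\<close>, only the even part of the singular translate counts; it is an approximate identity
  of Poisson type with opposite signs on the two sides. Hence the jump is \<open>\<plusminus> F(t - \<rho>)\<close>, which
  has a limit as \<open>t \<rightarrow> \<infinity>\<close> exactly when \<open>F\<close> has one.
\<close>

subsection \<open>Borel representatives of profiles\<close>

text \<open>\<open>F\<close> is only Lebesgue measurable and only given up to null sets, while the
  wave composes it with \<open>t - \<rho> * cosh \<beta>\<close>, and exchanging the integrals over
  \<open>t\<close> and \<open>\<beta>\<close> needs joint measurability. The analysis therefore runs
  on a Borel representative for which causality, growth and (when \<open>F\<close> converges) the
  limit hold at every point. The size of the jump comes out exactly. Near its pole a translate
  behaves like 1 / (q (\<beta> + i s \<epsilon>)), where s = 1 or s = -1 is the side of the ray, and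
  the even part of this integrates to -i s \<pi> / q. The two sides differ by -2 i \<pi> / q; as
  \<pi> / q = 2 \<Phi>, the prefactor i / (4 \<Phi>) turns this into 1, times the sign of the
  translate in Z. The converse must cope with whatever density \<open>jump_tendsto\<close> provides.
  The fundamental lemma of the calculus of variations identifies it almost everywhere. The test
  functions for that lemma are built explicitly, because membership in \<open>test_functions\<close>
  asks for differentiability of every iterated vector derivative.\<close>

lemma tendsto_ae_at_top_iff:
  fixes f :: "real \<Rightarrow> 'a::metric_space"
  shows "(f \<longlongrightarrow> c) ae_at_top \<longleftrightarrow> (\<forall>e>0. \<exists>T. AE s in lebesgue. T \<le> s \<longrightarrow> dist (f s) c < e)"
proof -
  have "eventually P ae_at_top \<longleftrightarrow> (\<exists>T. AE s in lebesgue. T \<le> s \<longrightarrow> P s)" for P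
  proof
    assume "eventually P ae_at_top"
    then obtain Q R where *: "eventually Q at_top" "AE s in lebesgue. R s" "\<And>s. Q s \<Longrightarrow> R s \<Longrightarrow> P s"
      unfolding eventually_inf by blast
    then obtain T where "\<And>s. T \<le> s \<Longrightarrow> Q s"
      unfolding eventually_at_top_linorder by blast
    with * show "\<exists>T. AE s in lebesgue. T \<le> s \<longrightarrow> P s"
      by (intro exI[of _ T]) (auto elim: eventually_mono)
  next
    assume "\<exists>T. AE s in lebesgue. T \<le> s \<longrightarrow> P s"
    then obtain T where "AE s in lebesgue. T \<le> s \<longrightarrow> P s" ..
    then show "eventually P ae_at_top"
      unfolding eventually_inf using eventually_ge_at_top[of T] by blast
  qed
  then show ?thesis
    by (simp add: tendsto_iff)
qed

lemma L1_loc_borel_measurable: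
  assumes "L1_loc f"
  shows "f \<in> borel_measurable lebesgue"
proof (rule borel_measurable_LIMSEQ_metric)
  fix n :: nat
  have "set_integrable lebesgue {- real n..real n} f"
    using assms unfolding L1_loc_def by blast
  then show "(\<lambda>x. indicator {- real n..real n} x *\<^sub>R f x) \<in> borel_measurable lebesgue"
    unfolding set_integrable_def by (rule borel_measurable_integrable)
next
  fix x :: real
  obtain N :: nat where "\<bar>x\<bar> < real N"
    using reals_Archimedean2 by blast
  then have "eventually (\<lambda>n. indicator {- real n..real n} x *\<^sub>R f x = f x) sequentially"
    by (intro eventually_sequentiallyI[of N]) (use \<open>\<bar>x\<bar> < real N\<close> in \<open>auto simp: indicator_def\<close>)
  then show "(\<lambda>n. indicator {- real n..real n} x *\<^sub>R f x) \<longlonglongrightarrow> f x"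
    by (rule tendsto_eventually)
qed

lemma lebesgue_measurable_borel_representative:
  fixes f :: "real \<Rightarrow> complex"
  assumes "f \<in> borel_measurable lebesgue"
  obtains g where "g \<in> borel_measurable borel" "AE x in lebesgue. f x = g x"
proof -
  have "(\<lambda>x. Re (f x)) \<in> borel_measurable lebesgue" "(\<lambda>x. Im (f x)) \<in> borel_measurable lebesgue"
    using assms by measurable
  then obtain u v where uv: "u \<in> borel_measurable lborel" "AE x in lborel. Re (f x) = u x"
      "v \<in> borel_measurable lborel" "AE x in lborel. Im (f x) = v x"
    by (metis completion_ex_borel_measurable_real)
  show thesis
  proof
    show "(\<lambda>x. Complex (u x) (v x)) \<in> borel_measurable borel"
      using uv unfolding Complex_eq by measurable
    have "AE x in lborel. f x = Complex (u x) (v x)"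
      using uv(2,4) by eventually_elim (auto simp: complex_eq_iff)
    then show "AE x in lebesgue. f x = Complex (u x) (v x)"
      by (rule AE_completion)
  qed
qed

text \<open>A null set of the completion need not be Borel, but a Borel null set covers it.
  Redefining a Borel function on such a set keeps it Borel.\<close>

lemma AE_lebesgue_borel_null_set:
  fixes P :: "real \<Rightarrow> bool"
  assumes "AE x in lebesgue. P x"
  obtains N :: "real set" where "N \<in> null_sets lborel" "\<And>x. x \<notin> N \<Longrightarrow> P x"
proof -
  have "AE x in lborel. P x"
    using assms by (simp add: AE_completion_iff)
  then show thesis
    using that unfolding eventually_ae_filter by auto
qed

text \<open>An essential limit amounts to countably many almost-everywhere statements, one for each
  tolerance 1 / (n + 1). Together with causality and growth they all hold off a single Borel null
  set, and the representative is corrected on that set alone.\<close>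

lemma profile_representative:
  fixes F :: "real \<Rightarrow> complex" and C :: complex
  assumes "L1_loc F" and supp: "AE s in lebesgue. s < 0 \<longrightarrow> F s = 0"
    and growth: "\<exists>M. AE s in lebesgue. (1 + \<bar>s\<bar>) powr p * norm (F s) \<le> M"
  obtains G :: "real \<Rightarrow> complex" and M :: real and m :: nat
  where "G \<in> borel_measurable borel" "AE s in lebesgue. F s = G s" "\<And>s. s < 0 \<Longrightarrow> G s = 0"
    "\<And>s. norm (G s) \<le> M * (1 + \<bar>s\<bar>) ^ m" "(F \<longlongrightarrow> C) ae_at_top \<Longrightarrow> (G \<longlongrightarrow> C) at_top"
proof -
  obtain G0 where G0: "G0 \<in> borel_measurable borel" "AE x in lebesgue. F x = G0 x"
    using lebesgue_measurable_borel_representative[OF L1_loc_borel_measurable[OF assms(1)]] .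
  obtain M where M: "AE s in lebesgue. (1 + \<bar>s\<bar>) powr p * norm (F s) \<le> M"
    using growth by blast
  \<comment> \<open>The convergence of \<open>F\<close> stays a premise inside the formula, so the
    same representative also serves the converse, where convergence is not yet known.\<close>
  have "\<exists>T. (F \<longlongrightarrow> C) ae_at_top \<longrightarrow> (AE s in lebesgue. T \<le> s \<longrightarrow> dist (F s) C < 1 / real (Suc n))" for n
    unfolding tendsto_ae_at_top_iff by (metis of_nat_0_less_iff zero_less_Suc zero_less_divide_1_iff)
  then obtain T where T: "\<And>n. (F \<longlongrightarrow> C) ae_at_top \<longrightarrow> (AE s in lebesgue. T n \<le> s \<longrightarrow> dist (F s) C < 1 / real (Suc n))"
    by metis
  have T': "AE s in lebesgue. \<forall>n. (F \<longlongrightarrow> C) ae_at_top \<longrightarrow> T n \<le> s \<longrightarrow> dist (F s) C < 1 / real (Suc n)"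
    using T by (subst AE_all_countable) (auto elim: eventually_mono)
  have "AE s in lebesgue. F s = G0 s \<and> (s < 0 \<longrightarrow> F s = 0) \<and> (1 + \<bar>s\<bar>) powr p * norm (F s) \<le> M \<and>
      (\<forall>n. (F \<longlongrightarrow> C) ae_at_top \<longrightarrow> T n \<le> s \<longrightarrow> dist (F s) C < 1 / real (Suc n))"
    using G0(2) supp M T' by eventually_elim blast
  then obtain N :: "real set" where N: "N \<in> null_sets lborel"
    and NP: "\<And>s. s \<notin> N \<Longrightarrow> F s = G0 s \<and> (s < 0 \<longrightarrow> F s = 0) \<and> (1 + \<bar>s\<bar>) powr p * norm (F s) \<le> M \<and>
      (\<forall>n. (F \<longlongrightarrow> C) ae_at_top \<longrightarrow> T n \<le> s \<longrightarrow> dist (F s) C < 1 / real (Suc n))"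
    by (rule AE_lebesgue_borel_null_set) blast
  have Nm[measurable]: "N \<in> sets borel"
    using N by auto
  note G0(1)[measurable]
  \<comment> \<open>On the null set, the value 0 on the left preserves causality and the value
    \<open>C\<close> on the right turns the essential limit into a pointwise one. The summand
    \<open>norm C\<close> in the growth bound pays for the latter.\<close>
  define G where "G s = (if s \<in> N then (if s < 0 then 0 else C) else G0 s)" for s
  \<comment> \<open>Undoing the weight costs the power \<open>-p\<close>, and \<open>-p\<close> is
    at most \<open>m\<close>.\<close>
  define m where "m = nat \<lceil>\<bar>p\<bar>\<rceil>"
  have "0 \<le> M"
  proof (rule ccontr)
    assume "\<not> 0 \<le> M"
    then have "s \<in> N" for s
      using NP[of s] by (smt (verit) mult_nonneg_nonneg norm_ge_zero powr_ge_zero)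
    then have "N = UNIV" by auto
    then show False using N by (auto simp: null_sets_def)
  qed
  show thesis
  proof
    show "G \<in> borel_measurable borel"
      unfolding G_def by measurable
    show "AE s in lebesgue. F s = G s"
      by (rule AE_completion, rule AE_I'[OF N]) (use NP in \<open>auto simp: G_def\<close>)
    show "G s = 0" if "s < 0" for s
      using NP[of s] that by (auto simp: G_def)
    show "norm (G s) \<le> (M + norm C) * (1 + \<bar>s\<bar>) ^ m" for s
    proof (cases "s \<in> N")
      case True
      have "norm (G s) \<le> (M + norm C) * 1"
        using True \<open>0 \<le> M\<close> by (auto simp: G_def)
      also have "\<dots> \<le> (M + norm C) * (1 + \<bar>s\<bar>) ^ m"
        using \<open>0 \<le> M\<close> by (intro mult_left_mono) auto
      finally show ?thesis .
    next
      case False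
      have "norm (G s) = (1 + \<bar>s\<bar>) powr (-p) * ((1 + \<bar>s\<bar>) powr p * norm (F s))"
        using NP[OF False] False by (simp add: G_def powr_minus field_simps)
      also have "\<dots> \<le> (1 + \<bar>s\<bar>) powr (-p) * M"
        using NP[OF False] by (intro mult_left_mono) auto
      also have "\<dots> \<le> (1 + \<bar>s\<bar>) powr (real m) * M"
        using \<open>0 \<le> M\<close> by (intro mult_right_mono powr_mono) (auto simp: m_def, linarith)
      also have "\<dots> \<le> (M + norm C) * (1 + \<bar>s\<bar>) ^ m"
        by (simp add: powr_realpow algebra_simps)
      finally show ?thesis .
    qed
    assume lim: "(F \<longlongrightarrow> C) ae_at_top"
    show "(G \<longlongrightarrow> C) at_top"
      unfolding tendsto_iff eventually_at_top_linorder
    proof (intro allI impI)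
      fix e :: real assume "0 < e"
      then obtain n where n: "1 / real (Suc n) < e"
        using nat_approx_posE by metis
      show "\<exists>S. \<forall>s\<ge>S. dist (G s) C < e"
      proof (intro exI[of _ "max 0 (T n)"] allI impI)
        fix s assume "max 0 (T n) \<le> s"
        then show "dist (G s) C < e"
          using NP[of s] lim n \<open>0 < e\<close> by (cases "s \<in> N") (fastforce simp: G_def)+
      qed
    qed
  qed
qed

text \<open>Differentiable maps carry null sets to null sets; this is applied to the two branches of
  the inverse, plus and minus \<open>arcosh\<close>. They are differentiable only on
  \<open>{1<..}\<close>, and the excluded value cosh \<beta> = 1 is attained only at \<beta> = 0,
  which \<open>insert 0\<close> adds to the null set.\<close>

lemma AE_comp_affine_cosh:
  fixes \<rho> t :: real and P :: "real \<Rightarrow> bool"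
  assumes "AE s in lebesgue. P s" and "\<rho> > 0"
  shows "AE \<beta> in lebesgue. P (t - \<rho> * cosh \<beta>)"
proof -
  obtain N :: "real set" where N: "N \<in> null_sets lborel" "\<And>x. x \<notin> N \<Longrightarrow> P x"
    by (rule AE_lebesgue_borel_null_set[OF assms(1)]) blast
  have "negligible N"
    using N(1) negligible_iff_null_sets null_sets_completionI by blast
  define N1 where "N1 = (\<lambda>s. (t - s) * inverse \<rho>) ` N \<inter> {1<..}"
  have "negligible N1"
    unfolding N1_def
    by (intro negligible_Int negligible_differentiable_image_negligible \<open>negligible N\<close>
        differentiable_on_mult differentiable_on_diff disjI1) auto
  moreover have "arcosh differentiable (at x within N1)" if "x \<in> N1" for x :: real
    using that unfolding N1_def real_differentiable_def
    by (blast intro: arcosh_real_has_field_derivative has_field_derivative_at_within)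
  then have 1: "arcosh differentiable_on N1"
    unfolding differentiable_on_def by blast
  moreover have 2: "(\<lambda>x. - arcosh x) differentiable_on N1"
    using 1 by (intro derivative_intros)
  ultimately have "negligible (insert 0 (arcosh ` N1 \<union> (\<lambda>x. - arcosh x) ` N1))"
    by (simp add: negligible_differentiable_image_negligible)
  then have null: "insert 0 (arcosh ` N1 \<union> (\<lambda>x. - arcosh x) ` N1) \<in> null_sets lebesgue"
    by (simp add: negligible_iff_null_sets)
  show ?thesis
  proof (rule AE_I'[OF null], intro subsetI, rule ccontr)
    fix \<beta> assume "\<beta> \<in> {\<beta> \<in> space lebesgue. \<not> P (t - \<rho> * cosh \<beta>)}"
      "\<beta> \<notin> insert 0 (arcosh ` N1 \<union> (\<lambda>x. - arcosh x) ` N1)"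
    then have *: "\<beta> \<notin> (\<lambda>x. - arcosh x) ` N1" "\<beta> \<notin> arcosh ` N1" "\<beta> \<noteq> 0" "\<not> P (t - \<rho> * cosh \<beta>)"
      by auto
    then have "t - \<rho> * cosh \<beta> \<in> N"
      using N by blast
    moreover have "cosh \<beta> > 1"
      using cosh_real_ge_1[of \<beta>] cosh_real_one_iff[of \<beta>] \<open>\<beta> \<noteq> 0\<close> by linarith
    ultimately have "cosh \<beta> \<in> N1"
      unfolding N1_def using assms by (auto intro!: image_eqI[of _ _ "t - \<rho> * cosh \<beta>"])
    moreover have "\<beta> = arcosh (cosh \<beta>) \<or> \<beta> = - arcosh (cosh \<beta>)"
      using arcosh_cosh_real[of \<beta>] arcosh_cosh_real[of "-\<beta>"] by (cases "\<beta> \<ge> 0") auto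
    ultimately show False
      using * by blast
  qed
qed

lemma AE_lebesgue_borel_measurable:
  fixes f g :: "real \<Rightarrow> complex"
  assumes "AE x in lebesgue. f x = g x" and "g \<in> borel_measurable lborel"
  shows "f \<in> borel_measurable lebesgue" "(LINT x|lebesgue. f x) = (LINT x|lborel. g x)"
    "integrable lebesgue f \<longleftrightarrow> integrable lborel g"
proof -
  have g: "g \<in> borel_measurable lebesgue"
    using assms(2) by (rule measurable_completion)
  show f: "f \<in> borel_measurable lebesgue"
    using borel_measurable_AE[OF g] assms(1) by (simp add: eq_commute)
  show "(LINT x|lebesgue. f x) = (LINT x|lborel. g x)"
    using integral_cong_AE[OF f g assms(1)] integral_completion[OF assms(2)] by simp
  show "integrable lebesgue f \<longleftrightarrow> integrable lborel g"
    using integrable_cong_AE[OF f g assms(1)] integrable_completion[OF assms(2)] by simp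
qed

lemma AE_lebesgue_shift:
  fixes P :: "real \<Rightarrow> bool" and c :: real
  assumes "AE s in lebesgue. P s"
  shows "AE s in lebesgue. P (s - c)"
proof -
  obtain N :: "real set" where N: "N \<in> null_sets lborel" "\<And>x. x \<notin> N \<Longrightarrow> P x"
    by (rule AE_lebesgue_borel_null_set[OF assms]) blast
  then show ?thesis
    by (intro AE_completion AE_I'[OF null_sets_translation[OF N(1), of c]]) auto
qed

subsection \<open>Bump functions and the fundamental lemma of the calculus of variations\<close>

text \<open>The exponents \<open>m\<close>, \<open>n\<close> make the linear span of this family closed under differentiation.\<close>

definition bump :: "real \<Rightarrow> real \<Rightarrow> real \<Rightarrow> nat \<Rightarrow> nat \<Rightarrow> real \<Rightarrow> real" where
  "bump c a b m n x =
     (if a < x \<and> x < b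
      then exp (- (c * inverse (x - a))) * inverse (x - a) ^ m *
        (exp (- (c * inverse (b - x))) * inverse (b - x) ^ n)
      else 0)"

lemma exp_neg_inverse_at_0:
  fixes c :: real
  assumes "c > 0"
  shows "((\<lambda>x. exp (- (c * inverse x)) * inverse x ^ m) \<longlongrightarrow> 0) (at_right 0)"
proof -
  have "((\<lambda>y. exp (- (c * y)) * y ^ m) \<longlongrightarrow> 0) at_top"
    using assms by real_asymp
  then show ?thesis
    by (rule filterlim_compose[OF _ filterlim_inverse_at_top_right])
qed

text \<open>The difference quotient costs one more factor \<open>inverse x\<close>, and the
  exponential beats every power of it. For a bump, \<open>g\<close> is the factor belonging to the
  opposite end point, which is regular here.\<close>

lemma flat_has_derivative_0:
  fixes f g :: "real \<Rightarrow> real"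
  assumes "c > 0" and g: "(g \<longlongrightarrow> l) (at_right 0)" 
    and pos: "eventually (\<lambda>x. f x = exp (- (c * inverse x)) * inverse x ^ m * g x) (at_right 0)"
    and neg: "\<And>x. x \<le> 0 \<Longrightarrow> f x = 0"
  shows "(f has_real_derivative 0) (at 0)"
proof -
  have "((\<lambda>x. exp (- (c * inverse x)) * inverse x ^ Suc m * g x) \<longlongrightarrow> 0 * l) (at_right 0)"
    by (intro tendsto_mult exp_neg_inverse_at_0 g \<open>c > 0\<close>)
  then have "((\<lambda>x. f x / x) \<longlongrightarrow> 0) (at_right 0)"
    by (simp, elim Lim_transform_eventually)
       (use pos in \<open>eventually_elim, simp add: field_simps\<close>)
  moreover have "((\<lambda>x. f x / x) \<longlongrightarrow> 0) (at_left 0)"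
    by (rule tendsto_eventually) (simp add: eventually_at_filter neg)
  ultimately have "((\<lambda>x. f x / x) \<longlongrightarrow> 0) (at 0)"
    by (simp add: filterlim_split_at)
  then show ?thesis
    by (simp add: has_field_derivative_iff neg)
qed

text \<open>This reduces the right end point to the left one.\<close>

lemma bump_reflect: "bump c a b m n x = bump c (-b) (-a) n m (-x)"
  by (auto simp: bump_def algebra_simps)

lemma bump_has_derivative_left_end:
  assumes "c > 0" "a < b"
  shows "(bump c a b m n has_real_derivative 0) (at a)"
proof -
  have "((\<lambda>h. bump c a b m n (a + h)) has_real_derivative 0) (at 0)"
  proof (rule flat_has_derivative_0[where c = c and m = m])
    show "((\<lambda>h. exp (- (c * inverse (b - (a + h)))) * inverse (b - (a + h)) ^ n)
        \<longlongrightarrow> exp (- (c * inverse (b - (a + 0)))) * inverse (b - (a + 0)) ^ n) (at_right 0)"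
      using assms by (intro tendsto_intros) auto
    show "\<forall>\<^sub>F h in at_right 0. bump c a b m n (a + h) = exp (- (c * inverse h)) * inverse h ^ m *
        (exp (- (c * inverse (b - (a + h)))) * inverse (b - (a + h)) ^ n)"
      unfolding eventually_at_right_field using assms
      by (intro exI[of _ "b - a"]) (auto simp: bump_def)
  qed (use assms in \<open>auto simp: bump_def\<close>)
  then show ?thesis
    using DERIV_shift[of "bump c a b m n" 0 0 a] by (simp add: add.commute)
qed

text \<open>At each end the power and the exponential raise the exponent by 1 and by 2 respectively,
  which gives the four terms. All of them vanish off the open interval, so one formula holds on the
  whole line, including the end points.\<close>

lemma bump_has_derivative:
  assumes "c > 0" "a < b"
  shows "(bump c a b m n has_real_derivative
    - real m * bump c a b (Suc m) n x + c * bump c a b (m + 2) n x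
    + real n * bump c a b m (Suc n) x - c * bump c a b m (n + 2) x) (at x)"
proof -
  consider "x < a \<or> b < x" | "x = a" | "x = b" | "a < x" "x < b"
    by linarith
  then show ?thesis
  proof cases
    case 1
    have "((\<lambda>x. 0) has_real_derivative 0) (at x)" by simp
    moreover have "open ({..<a} \<union> {b<..})" by auto
    ultimately have "(bump c a b m n has_real_derivative 0) (at x)"
      by (rule has_field_derivative_transform_within_open) (use 1 assms in \<open>auto simp: bump_def\<close>)
    then show ?thesis using 1 by (auto simp: bump_def)
  next
    case 2
    then show ?thesis using bump_has_derivative_left_end[OF assms] by (simp add: bump_def)
  next
    case 3
    have "(bump c (-b) (-a) n m has_real_derivative 0) (at (-b))"
      using assms by (intro bump_has_derivative_left_end) auto
    then have "((\<lambda>x. bump c (-b) (-a) n m (-x)) has_real_derivative 0) (at b)"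
      using DERIV_mirror by fastforce
    moreover have "(\<lambda>x. bump c (-b) (-a) n m (-x)) = bump c a b m n"
      using bump_reflect[of c a b m n] by auto
    ultimately show ?thesis using 3 by (simp add: bump_def)
  next
    case 4
    define u where "u x = exp (- (c * inverse (x - a)))" for x
    define v where "v x = exp (- (c * inverse (b - x)))" for x
    have u: "(u has_real_derivative c * inverse (x - a) ^ 2 * u x) (at x)"
      unfolding u_def using 4 by (auto intro!: derivative_eq_intros simp: power2_eq_square field_simps)
    have v: "(v has_real_derivative - c * inverse (b - x) ^ 2 * v x) (at x)"
      unfolding v_def using 4 by (auto intro!: derivative_eq_intros simp: power2_eq_square field_simps)
    \<comment> \<open>For \<open>k = 0\<close> the subtraction is truncated; the factor
      \<open>real k\<close> makes both sides 0 there.\<close>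
    have pw: "real k * y ^ (k - Suc 0) * y ^ 2 = real k * y ^ Suc k" for k and y :: real
      by (cases k) (auto simp: power2_eq_square)
    have p: "((\<lambda>x. inverse (x - a) ^ m) has_real_derivative - (real m * inverse (x - a) ^ Suc m)) (at x)"
      unfolding pw[symmetric]
      using 4 by (auto intro!: derivative_eq_intros simp: power2_eq_square)
    have r: "((\<lambda>x. inverse (b - x) ^ n) has_real_derivative real n * inverse (b - x) ^ Suc n) (at x)"
      unfolding pw[symmetric]
      using 4 by (auto intro!: derivative_eq_intros simp: power2_eq_square)
    have "((\<lambda>x. u x * inverse (x - a) ^ m * (v x * inverse (b - x) ^ n)) has_real_derivative
      - real m * bump c a b (Suc m) n x + c * bump c a b (m + 2) n x
      + real n * bump c a b m (Suc n) x - c * bump c a b m (n + 2) x) (at x)"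
      by (rule derivative_eq_intros u v p r refl)+
         (use 4 in \<open>simp add: bump_def u_def[symmetric] v_def[symmetric] power_add algebra_simps power2_eq_square\<close>)
    then show ?thesis
      by (rule has_field_derivative_transform_within_open[where S = "{a<..<b}"])
         (use 4 in \<open>auto simp: bump_def u_def v_def\<close>)
  qed
qed

text \<open>A class closed under differentiation contains all iterated derivatives of its members,
  so smoothness follows without any formula for the higher derivatives.\<close>

lemma iterated_vector_derivative_differentiable:
  fixes A :: "(real \<Rightarrow> complex) set"
  assumes "f \<in> A" and A: "\<And>f. f \<in> A \<Longrightarrow> \<exists>f'\<in>A. \<forall>x. (f has_vector_derivative f' x) (at x)"
  shows "((\<lambda>f y. vector_derivative f (at y)) ^^ n) f differentiable (at x)"
proof -
  have "((\<lambda>f y. vector_derivative f (at y)) ^^ n) f \<in> A"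
  proof (induction n)
    case (Suc n)
    let ?g = "((\<lambda>f y. vector_derivative f (at y)) ^^ n) f"
    obtain g' where "g' \<in> A" "\<And>x. (?g has_vector_derivative g' x) (at x)"
      using A[OF Suc] by blast
    then have "(\<lambda>y. vector_derivative ?g (at y)) = g'"
      by (auto intro!: ext vector_derivative_at)
    then show ?case using \<open>g' \<in> A\<close> by simp
  qed (use assms in simp)
  then show ?thesis
    using A differentiableI_vector by blast
qed

text \<open>The class closed under differentiation is the linear span of the bumps with fixed
  \<open>c\<close>, \<open>a\<close>, \<open>b\<close>. A list of triples (coefficient,
  \<open>m\<close>, \<open>n\<close>) encodes an element of the span as \<open>B I\<close>, and
  \<open>D\<close> replaces each triple by the four terms of its derivative.\<close>

lemma bump_test_function:
  assumes "c > 0" "a < b"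
  shows "(\<lambda>x. of_real (bump c a b 0 0 x)) \<in> test_functions"
proof -
  define B where "B I x = (\<Sum>(k, m, n)\<leftarrow>I. of_real (k * bump c a b m n x) :: complex)"
    for I :: "(real \<times> nat \<times> nat) list" and x
  define D where "D = concat \<circ> map (\<lambda>(k, m, n). [(- (k * real m), Suc m, n), (k * c, m + 2, n),
      (k * real n, m, Suc n), (- (k * c), m, n + 2)])"
  have der: "(B I has_vector_derivative B (D I) x) (at x)" for I x
  proof (induction I)
    case Nil
    show ?case by (simp add: B_def D_def)
  next
    case (Cons i I)
    obtain k m n where i: "i = (k, m, n)" by (cases i)
    have "((\<lambda>x. of_real (k * bump c a b m n x) :: complex) has_vector_derivative
       of_real (k * (- real m * bump c a b (Suc m) n x + c * bump c a b (m + 2) n x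
       + real n * bump c a b m (Suc n) x - c * bump c a b m (n + 2) x))) (at x)"
      by (intro has_vector_derivative_of_real has_real_derivative_iff_has_vector_derivative[THEN iffD1]
          DERIV_cmult bump_has_derivative assms)
    from has_vector_derivative_add[OF this Cons] show ?case
      by (simp add: B_def D_def i algebra_simps)
  qed
  have "((\<lambda>f y. vector_derivative f (at y)) ^^ n) (\<lambda>x. of_real (bump c a b 0 0 x) :: complex)
      differentiable (at x)" for n x
  proof (rule iterated_vector_derivative_differentiable[where A = "range B"])
    have "(\<lambda>x. of_real (bump c a b 0 0 x)) = B [(1, 0, 0)]"
      by (auto simp: B_def)
    then show "(\<lambda>x. of_real (bump c a b 0 0 x)) \<in> range B" by blast
  qed (use der in blast)
  moreover have "compact (closure {x. (of_real (bump c a b 0 0 x) :: complex) \<noteq> 0})"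
  proof -
    have "bounded {x. (of_real (bump c a b 0 0 x) :: complex) \<noteq> 0}"
      by (rule bounded_subset[of "{a..b}"]) (auto simp: bump_def split: if_splits)
    then show ?thesis by simp
  qed
  ultimately show ?thesis
    unfolding test_functions_def by blast
qed

text \<open>As the steepness c = 1 / (n + 1) tends to 0, both exponentials tend to 1 inside the
  interval. This is the passage from test functions to intervals.\<close>

lemma bump_tendsto_indicator:
  "((\<lambda>n. bump (1 / real (Suc n)) a b 0 0 x) \<longlonglongrightarrow> indicator {a<..<b} x)"
proof (cases "a < x \<and> x < b")
  case True
  have "(\<lambda>n. exp (- (1 / real (Suc n) * inverse (x - a))) * exp (- (1 / real (Suc n) * inverse (b - x))))
     \<longlonglongrightarrow> exp (- (0 * inverse (x - a))) * exp (- (0 * inverse (b - x)))"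
    by (intro tendsto_intros LIMSEQ_Suc[OF lim_1_over_n])
  then show ?thesis using True by (simp add: bump_def)
qed (auto simp: bump_def)

lemma bump_bounded: "c > 0 \<Longrightarrow> norm (of_real (bump c a b 0 0 x) :: complex) \<le> indicator {a..b} x"
  by (auto simp: bump_def indicator_def mult_exp_exp intro!: add_nonneg_nonneg order.trans[OF _ mult_nonneg_nonneg])

lemma sets_borel_eq_sigma_greaterThanLessThan: "sets (borel :: real measure) = sigma_sets UNIV (range (\<lambda>(a, b). {a<..<b}))"
  unfolding borel_eq_box case_prod_unfold box_real
  by (subst sets_measure_of) simp_all

text \<open>The open intervals are a generator of the Borel sets that is stable under intersection,
  so the vanishing of the integrals spreads to all Borel sets by a Dynkin argument. Uniqueness of
  densities, applied to real and imaginary parts, then finishes the proof.\<close>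

lemma AE_eq_0_if_interval_integrals_0:
  fixes f :: "real \<Rightarrow> complex"
  assumes "f \<in> borel_measurable borel" and int: "\<And>n. set_integrable lborel {- real n<..<real n} f"
    and zero: "\<And>a b. a < b \<Longrightarrow> (LINT x:{a<..<b}|lborel. f x) = 0"
  shows "AE x in lborel. f x = 0"
proof -
  note assms(1)[measurable]
  have 1: "AE x in lborel. indicator {- real n<..<real n} x *\<^sub>R f x = 0" for n
  proof -
    \<comment> \<open>The truncation makes the function integrable on the whole line, as complements
      and countable disjoint unions in the Dynkin argument require.\<close>
    define g where "g x = indicator {- real n<..<real n} x *\<^sub>R f x" for x
    have g: "integrable lborel g"
      using int[of n] unfolding set_integrable_def g_def .
    have set0: "(LINT x:A|lborel. g x) = 0" if "A \<in> sets borel" for A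
    proof -
      have "Int_stable (range (\<lambda>(a, b). {a<..<b::real}))"
        unfolding Int_stable_def
      proof safe
        fix a b c d :: real
        have "{a<..<b} \<inter> {c<..<d} = (\<lambda>(a, b). {a<..<b}) (max a c, min b d)"
          by auto
        then show "{a<..<b} \<inter> {c<..<d} \<in> range (\<lambda>(a, b). {a<..<b})"
          by blast
      qed
      moreover have "range (\<lambda>(a, b). {a<..<b::real}) \<subseteq> Pow UNIV" by simp
      moreover have "A \<in> sigma_sets UNIV (range (\<lambda>(a, b). {a<..<b::real}))"
        using that unfolding sets_borel_eq_sigma_greaterThanLessThan by simp
      ultimately show ?thesis
      proof (induction rule: sigma_sets_induct_disjoint)
        case (basic A)
        then obtain a b where A: "A = {a<..<b}" by auto
        have "(LINT x:A|lborel. g x) = (LINT x:{max a (- real n)<..<min b (real n)}|lborel. f x)"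
          unfolding A g_def set_lebesgue_integral_def
          by (intro Bochner_Integration.integral_cong) (auto simp: indicator_def)
        also have "\<dots> = 0"
          using zero[of "max a (- real n)" "min b (real n)"]
          by (cases "max a (- real n) < min b (real n)") (auto simp: greaterThanLessThan_empty set_lebesgue_integral_def)
        finally show ?case .
      next
        case empty
        show ?case by (simp add: set_lebesgue_integral_def)
      next
        case (compl A)
        have A: "A \<in> sets lborel"
          using compl(1) by (simp only: sets_lborel sets_borel_eq_sigma_greaterThanLessThan)
        have "(LINT x:UNIV|lborel. g x) = 0"
          using zero[of "- real n" "real n"]
          by (cases n) (auto simp: set_lebesgue_integral_def g_def)
        moreover have "(LINT x:UNIV|lborel. g x) = (LINT x:UNIV - A|lborel. g x) + (LINT x:A|lborel. g x)"
          using A g by (subst set_integral_Un[symmetric])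
            (auto simp: set_integrable_def integrable_mult_indicator)
        ultimately show ?case using compl by simp
      next
        case (union A)
        have A: "A i \<in> sets lborel" for i
          using union(2) unfolding sets_lborel sets_borel_eq_sigma_greaterThanLessThan by (rule range_subsetD)
        have "(LINT x:(\<Union>i. A i)|lborel. g x) = (\<Sum>i. LINT x:A i|lborel. g x)"
          using A union(1) g
          by (intro lebesgue_integral_countable_add)
             (auto simp: disjoint_family_on_def set_integrable_def intro!: integrable_mult_indicator)
        then show ?case using union by simp
      qed
    qed
    have "AE x in lborel. Re (g x) = 0"
    proof (rule density_unique_real)
      fix A :: "real set" assume "A \<in> sets lborel"
      moreover from this have "integrable lborel (\<lambda>x. indicator A x *\<^sub>R g x)"
        using g by (rule integrable_mult_indicator)
      then have "(LINT x:A|lborel. Re (g x)) = Re (LINT x:A|lborel. g x)"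
        unfolding set_lebesgue_integral_def by (subst integral_Re[symmetric]) auto
      ultimately show "(LINT x:A|lborel. Re (g x)) = (LINT x:A|lborel. 0)"
        using set0[of A] by simp
    qed (use g in auto)
    moreover have "AE x in lborel. Im (g x) = 0"
    proof (rule density_unique_real)
      fix A :: "real set" assume "A \<in> sets lborel"
      moreover from this have "integrable lborel (\<lambda>x. indicator A x *\<^sub>R g x)"
        using g by (rule integrable_mult_indicator)
      then have "(LINT x:A|lborel. Im (g x)) = Im (LINT x:A|lborel. g x)"
        unfolding set_lebesgue_integral_def by (subst integral_Im[symmetric]) auto
      ultimately show "(LINT x:A|lborel. Im (g x)) = (LINT x:A|lborel. 0)"
        using set0[of A] by simp
    qed (use g in auto)
    ultimately show ?thesis
      unfolding g_def by eventually_elim (simp add: complex_eq_iff)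
  qed
  then have "AE x in lborel. \<forall>n. indicator {- real n<..<real n} x *\<^sub>R f x = 0"
    by (subst AE_all_countable) blast
  then show ?thesis
  proof eventually_elim
    case (elim x)
    obtain n :: nat where "\<bar>x\<bar> < real n"
      using reals_Archimedean2 by blast
    then show ?case using elim[rule_format, of n] by (auto simp: indicator_def)
  qed
qed

text \<open>Bumps of vanishing steepness converge to the indicator of the open interval and are
  dominated by that of the closed one, so dominated convergence reduces the claim to integrals over
  intervals.\<close>

lemma fundamental_lemma_calculus_of_variations:
  fixes f :: "real \<Rightarrow> complex"
  assumes "f \<in> borel_measurable borel" and int: "\<And>n. set_integrable lborel {- real n..real n} f"
    and zero: "\<And>\<psi>. \<psi> \<in> test_functions \<Longrightarrow> (LINT x|lborel. f x * \<psi> x) = 0"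
  shows "AE x in lborel. f x = 0"
proof (rule AE_eq_0_if_interval_integrals_0[OF assms(1)])
  show "set_integrable lborel {- real n<..<real n} f" for n
    by (rule set_integrable_subset[OF int[of n]]) auto
  note assms(1)[measurable]
  fix a b :: real assume "a < b"
  obtain n :: nat where n: "max \<bar>a\<bar> \<bar>b\<bar> < real n"
    using reals_Archimedean2 by blast
  have "set_integrable lborel {a..b} f"
    by (rule set_integrable_subset[OF int[of n]]) (use n in auto)
  then have dom: "integrable lborel (\<lambda>x. norm (indicator {a..b} x *\<^sub>R f x))"
    unfolding set_integrable_def by (rule integrable_norm)
  have bm[measurable]: "bump c a b 0 0 \<in> borel_measurable borel" for c
    unfolding bump_def by measurable
  have "(\<lambda>n. LINT x|lborel. f x * of_real (bump (1 / real (Suc n)) a b 0 0 x))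
      \<longlonglongrightarrow> (LINT x|lborel. f x * of_real (indicator {a<..<b} x))"
  proof (rule integral_dominated_convergence[OF _ _ dom])
    show "AE x in lborel. (\<lambda>n. f x * of_real (bump (1 / real (Suc n)) a b 0 0 x))
        \<longlonglongrightarrow> f x * of_real (indicator {a<..<b} x)"
      by (intro AE_I2 tendsto_intros bump_tendsto_indicator)
    show "AE x in lborel. norm (f x * of_real (bump (1 / real (Suc n)) a b 0 0 x))
        \<le> norm (indicator {a..b} x *\<^sub>R f x)" for n
      using bump_bounded[of "1 / real (Suc n)" a b]
      by (intro AE_I2) (simp add: norm_mult mult.commute[of _ "norm (f _)"] mult_left_mono)
  qed measurable
  moreover have "(LINT x|lborel. f x * of_real (bump (1 / real (Suc n)) a b 0 0 x)) = 0" for n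
    by (intro zero bump_test_function \<open>a < b\<close>) auto
  ultimately have "(LINT x|lborel. f x * of_real (indicator {a<..<b} x)) = 0"
    by (simp add: LIMSEQ_const_iff)
  then show "(LINT x:{a<..<b}|lborel. f x) = 0"
    by (simp add: set_lebesgue_integral_def scaleR_conv_of_real mult.commute)
qed

subsection \<open>The kernel\<close>

text \<open>With \<open>z = x + i y\<close> this is \<open>1 / sinh z\<close> for \<open>DN\<close> and \<open>coth z - tanh x\<close> otherwise. The
  coefficients of the four hyperbolic cotangents in \<open>Z\<close> add up to zero, so subtracting \<open>tanh x\<close> from
  each of them does not change \<open>Z\<close>, but makes every summand decay.\<close>

definition edge_kernel :: "boundary_type \<Rightarrow> real \<Rightarrow> real \<Rightarrow> complex" where
  "edge_kernel b x y =
     (if b = DN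
      then Complex (sinh x * cos y / ((sinh x)\<^sup>2 + (sin y)\<^sup>2))
        (- (sin y * cosh x / ((sinh x)\<^sup>2 + (sin y)\<^sup>2)))
      else Complex (sinh x * (cos y)\<^sup>2 / (cosh x * ((sinh x)\<^sup>2 + (sin y)\<^sup>2)))
        (- (sin y * cos y / ((sinh x)\<^sup>2 + (sin y)\<^sup>2))))"

lemma sinh_cosh_cis:
  fixes x y :: real
  shows "sinh (of_real x + \<i> * of_real y) = Complex (sinh x * cos y) (cosh x * sin y)"
    and "cosh (of_real x + \<i> * of_real y) = Complex (cosh x * cos y) (sinh x * sin y)"
proof -
  have "sinh (\<i> * of_real y) = \<i> * of_real (sin y)" "cosh (\<i> * of_real y) = of_real (cos y)"
    using sin_conv_sinh[of "of_real y"] cos_conv_cosh[of "of_real y"]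
    by (simp_all add: sin_of_real cos_of_real complex_eq_iff)
  moreover have "sinh (of_real x) = (of_real (sinh x) :: complex)" "cosh (of_real x) = (of_real (cosh x) :: complex)"
    by (simp_all add: sinh_field_def cosh_field_def exp_of_real flip: of_real_minus)
  ultimately show "sinh (of_real x + \<i> * of_real y) = Complex (sinh x * cos y) (cosh x * sin y)"
    "cosh (of_real x + \<i> * of_real y) = Complex (cosh x * cos y) (sinh x * sin y)"
    by (simp_all add: sinh_add cosh_add complex_eq_iff)
qed

text \<open>The left-hand side is the squared modulus of sinh (x + i y). Dropping the first square
  on the right leaves the lower bound, which supplies the decay in \<open>x\<close> as long as sin y
  stays away from 0.\<close>

lemma sinh_sin_denominator:
  fixes x y :: real
  shows "(sinh x)\<^sup>2 + (sin y)\<^sup>2 = (sinh x * cos y)\<^sup>2 + (cosh x * sin y)\<^sup>2"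
    "(sinh x)\<^sup>2 + (sin y)\<^sup>2 \<ge> (sin y)\<^sup>2 * (cosh x)\<^sup>2"
proof -
  show 1: "(sinh x)\<^sup>2 + (sin y)\<^sup>2 = (sinh x * cos y)\<^sup>2 + (cosh x * sin y)\<^sup>2"
    unfolding power_mult_distrib cos_squared_eq cosh_square_eq by (simp add: algebra_simps)
  show "(sinh x)\<^sup>2 + (sin y)\<^sup>2 \<ge> (sin y)\<^sup>2 * (cosh x)\<^sup>2"
    unfolding 1 by (simp add: power_mult_distrib mult.commute)
qed

lemma inverse_sinh_eq_edge_kernel:
  "1 / sinh (of_real x + \<i> * of_real y) = edge_kernel DN x y"
  unfolding sinh_cosh_cis edge_kernel_def sinh_sin_denominator(1)
  by (simp add: complex_eq_iff Re_divide Im_divide power2_eq_square mult.commute)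

lemma ccoth_eq_edge_kernel:
  assumes "b \<noteq> DN"
  shows "ccoth (of_real x + \<i> * of_real y) = edge_kernel b x y + of_real (tanh x)"
proof (cases "(sinh x)\<^sup>2 + (sin y)\<^sup>2 = 0")
  \<comment> \<open>At a pole both sides are 0, because division by zero yields 0.\<close>
  case True
  then have "sinh x = 0" "sin y = 0"
    by (auto simp: sum_power2_eq_zero_iff)
  then show ?thesis
    using assms unfolding ccoth_def sinh_cosh_cis edge_kernel_def
      by (simp add: complex_eq_iff Re_divide Im_divide)
next
  case False
  define D where "D = (sinh x)\<^sup>2 + (sin y)\<^sup>2"
  have "Re (ccoth (of_real x + \<i> * of_real y)) =
      (sinh x * cosh x * (cos y)\<^sup>2 + sinh x * cosh x * (sin y)\<^sup>2) / D"
    unfolding ccoth_def sinh_cosh_cis D_def sinh_sin_denominator(1)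
    by (simp add: Re_divide power2_eq_square algebra_simps)
  also have "\<dots> = sinh x * cosh x / D"
    by (simp flip: distrib_left)
  also have "\<dots> = sinh x * (cos y)\<^sup>2 / (cosh x * D) + tanh x"
  proof -
    have "(cosh x)\<^sup>2 = (cos y)\<^sup>2 + D"
      unfolding D_def cosh_square_eq cos_squared_eq by simp
    then have "sinh x * (cosh x)\<^sup>2 = sinh x * (cos y)\<^sup>2 + sinh x * D"
      by (simp add: algebra_simps)
    then show ?thesis
      using False unfolding tanh_def D_def[symmetric] by (simp add: field_simps power2_eq_square)
  qed
  finally have re: "Re (ccoth (of_real x + \<i> * of_real y)) = sinh x * (cos y)\<^sup>2 / (cosh x * D) + tanh x" .
  have "Im (ccoth (of_real x + \<i> * of_real y)) = sin y * cos y * ((sinh x)\<^sup>2 - (cosh x)\<^sup>2) / D"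
    unfolding ccoth_def sinh_cosh_cis D_def sinh_sin_denominator(1)
    by (simp add: Im_divide power2_eq_square algebra_simps)
  then have "Im (ccoth (of_real x + \<i> * of_real y)) = - (sin y * cos y / D)"
    by (simp add: cosh_square_eq)
  with re show ?thesis
    using assms by (simp add: complex_eq_iff edge_kernel_def D_def)
qed

text \<open>coth has period i \<pi>, while 1 / sinh changes sign under this shift. This moves the
  pole of Z at the angle 4 \<pi> - \<alpha> to the first critical angle.\<close>

lemma edge_kernel_minus_pi:
  "edge_kernel b x (y - pi) = (if b = DN then - edge_kernel b x y else edge_kernel b x y)"
  by (auto simp: edge_kernel_def complex_eq_iff)

text \<open>The real part is odd in \<open>x\<close> and the imaginary part is even. The purely
  imaginary sum is what survives integration against an even function.\<close>

lemma edge_kernel_reflect: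
  "edge_kernel b x y + edge_kernel b (- x) y =
     2 * (- \<i>) * of_real (sin y * (if b = DN then cosh x else cos y) / ((sinh x)\<^sup>2 + (sin y)\<^sup>2))"
  by (auto simp: edge_kernel_def complex_eq_iff)

text \<open>For \<open>DN\<close> the modulus is exactly 1 / \<bar>sinh z\<bar>. In the other cases
  the subtraction of tanh x leaves this modulus times \<bar>cos y\<bar> / cosh x, which is at most
  1.\<close>

lemma norm_edge_kernel_le:
  assumes "sin y \<noteq> 0"
  shows "norm (edge_kernel b x y) \<le> 1 / (\<bar>sin y\<bar> * cosh x)"
proof -
  define D where "D = (sinh x)\<^sup>2 + (sin y)\<^sup>2"
  have D: "D > 0"
    using assms unfolding D_def by (simp add: add_nonneg_pos)
  have "(norm (edge_kernel b x y))\<^sup>2 \<le> 1 / D"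
  proof (cases "b = DN")
    case True
    have "(norm (edge_kernel b x y))\<^sup>2 = ((sinh x * cos y)\<^sup>2 + (cosh x * sin y)\<^sup>2) / D\<^sup>2"
      using True unfolding edge_kernel_def D_def[symmetric]
      by (simp add: cmod_power2 power_divide add_divide_distrib mult.commute)
    also have "\<dots> = 1 / D"
      unfolding sinh_sin_denominator(1)[symmetric] D_def[symmetric] by (simp add: power2_eq_square)
    finally show ?thesis by simp
  next
    case False
    have "(norm (edge_kernel b x y))\<^sup>2 = (cos y)\<^sup>2 * ((sinh x * cos y)\<^sup>2 + (cosh x * sin y)\<^sup>2) / ((cosh x)\<^sup>2 * D\<^sup>2)"
      using False D unfolding edge_kernel_def D_def[symmetric]
      by (simp add: cmod_power2) (simp add: field_simps power2_eq_square)
    also have "\<dots> = (cos y)\<^sup>2 / (cosh x)\<^sup>2 * (1 / D)"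
      unfolding sinh_sin_denominator(1)[symmetric] D_def[symmetric] using D by (simp add: power2_eq_square)
    also have "\<dots> \<le> 1 * (1 / D)"
    proof (rule mult_right_mono)
      have "(cos y)\<^sup>2 \<le> 1 ^ 2" "1 ^ 2 \<le> (cosh x)\<^sup>2"
        by (simp_all add: abs_square_le_1 cosh_real_ge_1)
      then show "(cos y)\<^sup>2 / (cosh x)\<^sup>2 \<le> 1"
        by (simp add: divide_le_eq)
    qed (use D in simp)
    finally show ?thesis by simp
  qed
  also have "\<dots> \<le> 1 / ((sin y)\<^sup>2 * (cosh x)\<^sup>2)"
    unfolding D_def using assms by (intro divide_left_mono sinh_sin_denominator(2)) (auto simp: add_nonneg_pos)
  also have "\<dots> = (1 / (\<bar>sin y\<bar> * cosh x))\<^sup>2"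
    by (simp add: power_divide power_mult_distrib)
  finally show ?thesis
    by (rule power2_le_imp_le) simp
qed

lemma continuous_on_edge_kernel [continuous_intros]:
  fixes f g :: "'a::t2_space \<Rightarrow> real"
  assumes "continuous_on A f" "continuous_on A g" "\<And>x. x \<in> A \<Longrightarrow> sin (g x) \<noteq> 0"
  shows "continuous_on A (\<lambda>x. edge_kernel b (f x) (g x))"
proof -
  have nz: "\<forall>x\<in>A. (sinh (f x))\<^sup>2 + (sin (g x))\<^sup>2 \<noteq> 0"
    using assms(3) by (simp add: sum_power2_eq_zero_iff)
  note intros = continuous_on_add continuous_on_mult continuous_on_const continuous_on_of_real
    continuous_on_minus continuous_on_divide continuous_on_power continuous_on_sinh
    continuous_on_cosh continuous_on_sin continuous_on_cos assms(1,2)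
  show ?thesis
  proof (cases "b = DN")
    case True
    show ?thesis
      unfolding edge_kernel_def Complex_eq if_P[OF True] by (intro intros nz)
  next
    case False
    have "\<forall>x\<in>A. cosh (f x) * ((sinh (f x))\<^sup>2 + (sin (g x))\<^sup>2) \<noteq> 0"
      using nz by simp
    then show ?thesis
      unfolding edge_kernel_def Complex_eq if_not_P[OF False] by (intro intros nz)
  qed
qed

lemma borel_measurable_edge_kernel [measurable (raw)]:
  assumes [measurable]: "f \<in> borel_measurable M" "g \<in> borel_measurable M"
  shows "(\<lambda>x. edge_kernel b (f x) (g x)) \<in> borel_measurable M"
proof -
  have [measurable]: "sinh \<in> borel_measurable (borel :: real measure)" "cosh \<in> borel_measurable (borel :: real measure)"
    by (auto intro!: borel_measurable_continuous_onI continuous_intros)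
  show ?thesis
    unfolding edge_kernel_def Complex_eq by measurable
qed

lemma abs_le_abs_sinh: "\<bar>x\<bar> \<le> \<bar>sinh (x::real)\<bar>"
  using real_le_abs_sinh[of x] by (simp add: sinh_field_def exp_minus)

lemma abs_le_cosh: "\<bar>x\<bar> \<le> cosh (x::real)"
proof -
  have "\<bar>x\<bar> \<le> \<bar>sinh x\<bar>"
    by (rule abs_le_abs_sinh)
  also have "\<dots> \<le> cosh x"
    using sinh_le_cosh_real[of "\<bar>x\<bar>"] by simp
  finally show ?thesis .
qed

lemma integrable_inverse_1_plus_sq: "integrable lborel (\<lambda>x::real. inverse (1 + x\<^sup>2))"
  and integral_inverse_1_plus_sq: "(LINT x|lborel. inverse (1 + x\<^sup>2 :: real)) = pi"
  using integrable_inverse_1_plus_square LBINT_inverse_1_plus_square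
  by (simp_all add: set_integrable_def set_lebesgue_integral_def einterval_eq interval_lebesgue_integral_def)

lemma integrable_inverse_cosh:
  fixes q :: real
  assumes "q > 0"
  shows "integrable lborel (\<lambda>\<beta>. 1 / cosh (q * \<beta>))"
proof -
  have "integrable lborel (\<lambda>x::real. 2 * inverse (1 + x\<^sup>2))"
    by (intro integrable_mult_right integrable_inverse_1_plus_sq)
  then have "integrable lborel (\<lambda>x::real. 1 / cosh x)"
  proof (rule Bochner_Integration.integrable_bound)
    have "(cosh :: real \<Rightarrow> real) \<in> borel_measurable borel"
      by (auto intro!: borel_measurable_continuous_onI continuous_intros)
    then show "(\<lambda>x::real. 1 / cosh x) \<in> borel_measurable lborel"
      by measurable
    show "AE x::real in lborel. norm (1 / cosh x) \<le> norm (2 * inverse (1 + x\<^sup>2))"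
    proof (rule AE_I2)
      fix x :: real
      have "\<bar>x / 2\<bar> \<le> \<bar>sinh (x / 2)\<bar>"
        by (rule abs_le_abs_sinh)
      then have "(x / 2)\<^sup>2 \<le> (sinh (x / 2))\<^sup>2"
        by (simp only: abs_le_square_iff)
      moreover have "cosh x = 1 + 2 * (sinh (x / 2))\<^sup>2"
        using cosh_double[of "x / 2"] cosh_square_eq[of "x / 2"] by simp
      ultimately have "(1 + x\<^sup>2) / 2 \<le> cosh x"
        by (simp add: power_divide)
      then have "1 / cosh x \<le> 1 / ((1 + x\<^sup>2) / 2)"
        by (intro divide_left_mono) (auto simp: add_pos_nonneg)
      then show "norm (1 / cosh x) \<le> norm (2 * inverse (1 + x\<^sup>2))"
        by (simp add: inverse_eq_divide)
    qed
  qed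
  from lborel_integrable_real_affine[OF this, of q 0] show ?thesis
    using assms by simp
qed

text \<open>The two shifts in Z and the two translates in H place the poles at the angles \<alpha>,
  2 \<pi> - \<alpha>, 2 \<pi> + \<alpha> and 4 \<pi> - \<alpha>. The last one exceeds the first
  critical angle by 2 \<Phi>, and q times 2 \<Phi> is \<pi>, so periodicity identifies the two. For
  \<open>DN\<close> the sign change under this shift is the source of
  \<open>jump_sign DN 1 = - 1\<close>.\<close>

lemma kernel_Z_decomposition:
  fixes b :: boundary_type and \<phi> \<alpha> \<beta> \<theta> :: real
  assumes "\<phi> < 2 * pi"
  defines "e \<equiv> \<lambda>a. edge_kernel b (wedge_q \<phi> * \<beta>) (wedge_q \<phi> * (\<theta> - a))"
  shows "kernel_Z b \<phi> \<alpha> (of_real \<beta> + \<i> * of_real \<theta>) =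
    jump_sign b 1 * e (critical_angle \<phi> \<alpha> 1) + jump_sign b 2 * e (critical_angle \<phi> \<alpha> 2)
    - e \<alpha> + e (2 * pi + \<alpha>)"
proof -
  define q where "q = wedge_q \<phi>"
  define w where "w a = complex_of_real (q * \<beta>) + \<i> * of_real (q * (\<theta> - a))" for a
  have shift: "q * (\<theta> - (4 * pi - \<alpha>)) = q * (\<theta> - critical_angle \<phi> \<alpha> 1) - pi"
    using assms(1) unfolding q_def wedge_q_def Phi_def critical_angle_def by (simp add: field_simps)
  have args: "of_real q * (of_real \<beta> + \<i> * of_real \<theta> - \<i> * of_real pi / 2 + \<i> * of_real pi / 2 - \<i> * of_real \<alpha>) = w \<alpha>"
    "of_real q * (of_real \<beta> + \<i> * of_real \<theta> - \<i> * of_real pi / 2 - 3 * \<i> * of_real pi / 2 + \<i> * of_real \<alpha>)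
      = w (2 * pi - \<alpha>)"
    "of_real q * (of_real \<beta> + \<i> * of_real \<theta> - 5 * \<i> * of_real pi / 2 + \<i> * of_real pi / 2 - \<i> * of_real \<alpha>)
      = w (2 * pi + \<alpha>)"
    "of_real q * (of_real \<beta> + \<i> * of_real \<theta> - 5 * \<i> * of_real pi / 2 - 3 * \<i> * of_real pi / 2 + \<i> * of_real \<alpha>)
      = w (4 * pi - \<alpha>)"
    by (simp_all add: w_def algebra_simps)
  have e4: "edge_kernel b (q * \<beta>) (q * (\<theta> - (4 * pi - \<alpha>))) =
      (if b = DN then - e (critical_angle \<phi> \<alpha> 1) else e (critical_angle \<phi> \<alpha> 1))"
    unfolding shift edge_kernel_minus_pi by (simp add: e_def q_def)
  have ca: "critical_angle \<phi> \<alpha> 2 = 2 * pi - \<alpha>"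
    by (simp add: critical_angle_def)
  show ?thesis
  proof (cases b)
    case DN
    have "1 / sinh (w a) = edge_kernel DN (q * \<beta>) (q * (\<theta> - a))" for a
      unfolding w_def by (rule inverse_sinh_eq_edge_kernel)
    then show ?thesis
      using e4 unfolding kernel_Z_def DN kernel_H.simps q_def[symmetric] args ca
      by (simp add: e_def DN q_def jump_sign_def)
  next
    case DD
    have "ccoth (w a) = edge_kernel DD (q * \<beta>) (q * (\<theta> - a)) + of_real (tanh (q * \<beta>))" for a
      unfolding w_def by (rule ccoth_eq_edge_kernel) simp
    then show ?thesis
      using e4 unfolding kernel_Z_def DD kernel_H.simps q_def[symmetric] args ca
      by (simp add: e_def DD q_def jump_sign_def)
  next
    case NN
    have "ccoth (w a) = edge_kernel NN (q * \<beta>) (q * (\<theta> - a)) + of_real (tanh (q * \<beta>))" for a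
      unfolding w_def by (rule ccoth_eq_edge_kernel) simp
    then show ?thesis
      using e4 unfolding kernel_Z_def NN kernel_H.simps q_def[symmetric] args ca
      by (simp add: e_def NN q_def jump_sign_def)
  qed
qed

subsection \<open>Approximate identity\<close>

lemma dominated_convergence_at_right_0:
  fixes s :: "real \<Rightarrow> 'a \<Rightarrow> 'b::{banach, second_countable_topology}"
  assumes "f \<in> borel_measurable M" "\<And>e. s e \<in> borel_measurable M" "integrable M w"
    and lim: "AE x in M. ((\<lambda>e. s e x) \<longlongrightarrow> f x) (at_right 0)"
    and bound: "\<forall>\<^sub>F e in at_right 0. AE x in M. norm (s e x) \<le> w x"
  shows "((\<lambda>e. integral\<^sup>L M (s e)) \<longlongrightarrow> integral\<^sup>L M f) (at_right 0)"
  unfolding filterlim_at_right_to_top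
proof (rule integral_dominated_convergence_at_top[OF assms(1-3)])
  show "AE x in M. ((\<lambda>t. s (inverse t) x) \<longlongrightarrow> f x) at_top"
    using lim unfolding filterlim_at_right_to_top .
  show "\<forall>\<^sub>F t in at_top. AE x in M. norm (s (inverse t) x) \<le> w x"
    using bound unfolding eventually_at_right_to_top .
qed

lemma continuous_compact_support_bounded:
  fixes K :: "real \<Rightarrow> 'a::real_normed_vector"
  assumes "continuous_on UNIV K" "\<And>x. \<bar>x\<bar> > B \<Longrightarrow> K x = 0"
  obtains L where "L \<ge> 0" "\<And>x. norm (K x) \<le> L"
proof -
  have "bounded (K ` {-B..B})"
    using assms(1) by (intro compact_imp_bounded compact_continuous_image continuous_on_subset[OF assms(1)]) auto
  then obtain L where L: "\<And>x. x \<in> {-B..B} \<Longrightarrow> norm (K x) \<le> L"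
    unfolding bounded_iff by blast
  show thesis
  proof
    show "norm (K x) \<le> max 0 L" for x
      using L[of x] assms(2)[of x] by (cases "\<bar>x\<bar> > B") (auto simp: not_less abs_le_iff le_max_iff_disj)
  qed auto
qed

lemma continuous_compact_support_integrable:
  fixes K :: "real \<Rightarrow> 'a::{banach, second_countable_topology}"
  assumes "continuous_on UNIV K" "\<And>x. \<bar>x\<bar> > B \<Longrightarrow> K x = 0"
  shows "integrable lborel K"
proof -
  have "integrable lborel (\<lambda>x. indicator {-B..B} x *\<^sub>R K x)"
    by (rule borel_integrable_compact) (auto intro: continuous_on_subset[OF assms(1)])
  moreover have "indicator {-B..B} x *\<^sub>R K x = K x" for x
    using assms(2)[of x] by (auto simp: indicator_def)
  ultimately show ?thesis by simp
qed

lemma lborel_integral_even_part: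
  fixes f :: "real \<Rightarrow> 'a::{banach, second_countable_topology}"
  assumes "integrable lborel f"
  shows "(LINT x|lborel. f x) = (LINT x|lborel. (1 / 2) *\<^sub>R (f x + f (- x)))"
proof -
  have "integrable lborel (\<lambda>x. f (- x))"
    using lborel_integrable_real_affine[OF assms, of "-1" 0] by simp
  then have "(LINT x|lborel. (1 / 2) *\<^sub>R (f x + f (- x))) =
      (1 / 2) *\<^sub>R ((LINT x|lborel. f x) + (LINT x|lborel. f (- x)))"
    using assms by simp
  also have "(LINT x|lborel. f (- x)) = (LINT x|lborel. f x)"
    using lborel_integral_real_affine[of "-1" f 0] by simp
  finally show ?thesis by (simp flip: scaleR_2)
qed

lemma has_real_derivative_quotient_at_right_0:
  assumes "(f has_real_derivative D) (at 0)" "f 0 = 0"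
  shows "((\<lambda>e. f e / e) \<longlongrightarrow> D) (at_right 0)"
  using assms unfolding has_field_derivative_iff by (auto intro: tendsto_within_subset)

text \<open>Only the part of the kernel that is even in \<open>\<beta>\<close> contributes, since \<open>K\<close> is even. Rescaled by
  \<open>\<beta> = \<epsilon> v\<close> it tends to a multiple of the Poisson kernel \<open>1 / (1 + v\<^sup>2)\<close>.\<close>

lemma edge_kernel_approximate_identity:
  fixes K :: "real \<Rightarrow> complex" and q s B :: real
  assumes q: "q > 0" and s: "s \<in> {1, -1}" and cont: "continuous_on UNIV K"
    and even: "\<And>\<beta>. K (- \<beta>) = K \<beta>" and supp: "\<And>\<beta>. \<bar>\<beta>\<bar> > B \<Longrightarrow> K \<beta> = 0"
  shows "((\<lambda>\<epsilon>. LINT \<beta>|lborel. edge_kernel b (q * \<beta>) (q * (s * \<epsilon>)) * K \<beta>)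
    \<longlongrightarrow> - \<i> * of_real (s * pi / q) * K 0) (at_right 0)"
proof -
  define h where "h x y = (if b = DN then cosh x else cos y)" for x y :: real
  define k where "k \<epsilon> \<beta> = sin (q * (s * \<epsilon>)) * h (q * \<beta>) (q * (s * \<epsilon>)) /
      ((sinh (q * \<beta>))\<^sup>2 + (sin (q * (s * \<epsilon>)))\<^sup>2)" for \<epsilon> \<beta>
  \<comment> \<open>\<open>X\<close> and \<open>Y\<close> are difference quotients at 0, with limits
    q v and q s. Dividing numerator and denominator of the rescaled kernel by the square of
    \<epsilon> expresses it through them, and the factor \<open>h\<close> tends to 1.\<close>
  define X where "X \<epsilon> v = sinh (q * (\<epsilon> * v)) / \<epsilon>" for \<epsilon> v
  define Y where "Y \<epsilon> = sin (q * (s * \<epsilon>)) / \<epsilon>" for \<epsilon>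
  define w where "w \<epsilon> v = of_real (\<epsilon> * k \<epsilon> (\<epsilon> * v)) * K (\<epsilon> * v)" for \<epsilon> v
  have s2: "s\<^sup>2 = 1" "\<bar>s\<bar> = 1" using s by auto
  have sinh_m[measurable]: "sinh \<in> borel_measurable (borel :: real measure)"
    and cosh_m[measurable]: "cosh \<in> borel_measurable (borel :: real measure)"
    and K_m[measurable]: "K \<in> borel_measurable borel"
    by (auto intro!: borel_measurable_continuous_onI continuous_intros cont)
  have small: "\<forall>\<^sub>F \<epsilon> in at_right 0. 0 < \<epsilon> \<and> sin (q * (s * \<epsilon>)) \<noteq> 0"
    unfolding eventually_at_right_field
  proof (intro exI[of _ "pi / q"] conjI allI impI)
    fix \<epsilon> assume "0 < \<epsilon>" "\<epsilon> < pi / q"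
    then have "sin (q * \<epsilon>) > 0"
      using q by (intro sin_gt_zero) (auto simp: field_simps)
    then show "sin (q * (s * \<epsilon>)) \<noteq> 0"
      using s by auto
  qed (use q in auto)
  have rescale: "(LINT \<beta>|lborel. edge_kernel b (q * \<beta>) (q * (s * \<epsilon>)) * K \<beta>) = - \<i> * (LINT v|lborel. w \<epsilon> v)"
    if "0 < \<epsilon> \<and> sin (q * (s * \<epsilon>)) \<noteq> 0" for \<epsilon>
  proof -
    let ?f = "\<lambda>\<beta>. edge_kernel b (q * \<beta>) (q * (s * \<epsilon>)) * K \<beta>"
    have even_part: "(1 / 2) *\<^sub>R (?f \<beta> + ?f (- \<beta>)) = - \<i> * (of_real (k \<epsilon> \<beta>) * K \<beta>)" for \<beta>
    proof -
      have "?f \<beta> + ?f (- \<beta>) = (edge_kernel b (q * \<beta>) (q * (s * \<epsilon>)) +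
          edge_kernel b (- (q * \<beta>)) (q * (s * \<epsilon>))) * K \<beta>"
        by (simp add: even distrib_right)
      then show ?thesis
        unfolding edge_kernel_reflect by (simp add: k_def h_def scaleR_conv_of_real)
    qed
    have "integrable lborel ?f"
      by (rule continuous_compact_support_integrable[where B = B])
        (use that supp in \<open>auto intro!: continuous_intros cont\<close>)
    then have "(LINT \<beta>|lborel. ?f \<beta>) = (LINT \<beta>|lborel. (1 / 2) *\<^sub>R (?f \<beta> + ?f (- \<beta>)))"
      by (rule lborel_integral_even_part)
    also have "\<dots> = (LINT \<beta>|lborel. - \<i> * (of_real (k \<epsilon> \<beta>) * K \<beta>))"
      by (simp only: even_part)
    also have "\<dots> = - \<i> * (LINT \<beta>|lborel. of_real (k \<epsilon> \<beta>) * K \<beta>)"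
      by (rule integral_mult_right_zero)
    also have "(LINT \<beta>|lborel. of_real (k \<epsilon> \<beta>) * K \<beta>) = (LINT v|lborel. w \<epsilon> v)"
    proof -
      have "(LINT \<beta>|lborel. of_real (k \<epsilon> \<beta>) * K \<beta>) =
          \<bar>\<epsilon>\<bar> *\<^sub>R (LINT v|lborel. of_real (k \<epsilon> (0 + \<epsilon> * v)) * K (0 + \<epsilon> * v))"
        using that by (intro lborel_integral_real_affine) auto
      also have "\<dots> = (LINT v|lborel. \<epsilon> *\<^sub>R (of_real (k \<epsilon> (\<epsilon> * v)) * K (\<epsilon> * v)))"
        using that by (simp only: integral_scaleR_right abs_of_pos add_0_left)
      also have "\<dots> = (LINT v|lborel. w \<epsilon> v)"
        by (simp only: w_def scaleR_conv_of_real of_real_mult mult.assoc)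
      finally show ?thesis .
    qed
    finally show ?thesis .
  qed
  have wXY: "w \<epsilon> v = of_real (h (q * (\<epsilon> * v)) (q * (s * \<epsilon>)) * (Y \<epsilon> / ((X \<epsilon> v)\<^sup>2 + (Y \<epsilon>)\<^sup>2))) * K (\<epsilon> * v)"
    if "\<epsilon> > 0" for \<epsilon> v
  proof -
    have "(X \<epsilon> v)\<^sup>2 + (Y \<epsilon>)\<^sup>2 = ((sinh (q * (\<epsilon> * v)))\<^sup>2 + (sin (q * (s * \<epsilon>)))\<^sup>2) / \<epsilon>\<^sup>2"
      by (simp add: X_def Y_def power_divide add_divide_distrib)
    then have "\<epsilon> * k \<epsilon> (\<epsilon> * v) = h (q * (\<epsilon> * v)) (q * (s * \<epsilon>)) * (Y \<epsilon> / ((X \<epsilon> v)\<^sup>2 + (Y \<epsilon>)\<^sup>2))"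
      using that by (simp add: k_def Y_def power2_eq_square)
    then show ?thesis
      unfolding w_def by simp
  qed
  have Y_lim: "(Y \<longlongrightarrow> q * s) (at_right 0)"
    unfolding Y_def[abs_def]
    by (rule has_real_derivative_quotient_at_right_0) (auto intro!: derivative_eq_intros)
  have X_lim: "((\<lambda>\<epsilon>. X \<epsilon> v) \<longlongrightarrow> q * v) (at_right 0)" for v
    unfolding X_def[abs_def]
    by (rule has_real_derivative_quotient_at_right_0) (auto intro!: derivative_eq_intros)
  have w_lim: "((\<lambda>\<epsilon>. w \<epsilon> v) \<longlongrightarrow> of_real (s / q * inverse (1 + v\<^sup>2)) * K 0) (at_right 0)" for v
  proof -
    have id: "((\<lambda>\<epsilon>. \<epsilon>) \<longlongrightarrow> 0) (at_right (0::real))"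
      by (rule tendsto_ident_at)
    have "((\<lambda>\<epsilon>. h (q * (\<epsilon> * v)) (q * (s * \<epsilon>))) \<longlongrightarrow> h (q * (0 * v)) (q * (s * 0))) (at_right 0)"
      unfolding h_def by (cases "b = DN") (auto intro!: tendsto_eq_intros)
    then have H: "((\<lambda>\<epsilon>. h (q * (\<epsilon> * v)) (q * (s * \<epsilon>))) \<longlongrightarrow> 1) (at_right 0)"
      by (simp add: h_def split: if_splits)
    have "((\<lambda>\<epsilon>. \<epsilon> * v) \<longlongrightarrow> 0 * v) (at_right 0)"
      by (intro tendsto_intros)
    then have KK: "((\<lambda>\<epsilon>. K (\<epsilon> * v)) \<longlongrightarrow> K 0) (at_right 0)"
      using continuous_on_tendsto_compose[OF cont, of "\<lambda>\<epsilon>. \<epsilon> * v" 0 "at_right 0"] by simp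
    have nz: "(q * v)\<^sup>2 + (q * s)\<^sup>2 > 0"
      using q s2 by (simp add: power_mult_distrib add_nonneg_pos)
    have "((\<lambda>\<epsilon>. of_real (h (q * (\<epsilon> * v)) (q * (s * \<epsilon>)) * (Y \<epsilon> / ((X \<epsilon> v)\<^sup>2 + (Y \<epsilon>)\<^sup>2))) * K (\<epsilon> * v))
       \<longlongrightarrow> of_real (1 * ((q * s) / ((q * v)\<^sup>2 + (q * s)\<^sup>2))) * K 0) (at_right 0)"
      using nz by (intro tendsto_intros H KK X_lim Y_lim) auto
    moreover have "(q * s) / ((q * v)\<^sup>2 + (q * s)\<^sup>2) = s / q * inverse (1 + v\<^sup>2)"
    proof -
      have "(q * v)\<^sup>2 + (q * s)\<^sup>2 = q * (q * (1 + v\<^sup>2))"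
        by (simp add: power_mult_distrib s2) (simp add: power2_eq_square algebra_simps)
      then show ?thesis using q by (simp add: inverse_eq_divide)
    qed
    moreover have "\<forall>\<^sub>F \<epsilon> in at_right 0. of_real (h (q * (\<epsilon> * v)) (q * (s * \<epsilon>)) *
        (Y \<epsilon> / ((X \<epsilon> v)\<^sup>2 + (Y \<epsilon>)\<^sup>2))) * K (\<epsilon> * v) = w \<epsilon> v"
      using small by eventually_elim (simp add: wXY)
    ultimately show ?thesis
      by (simp add: Lim_transform_eventually)
  qed
  obtain L where L: "L \<ge> 0" "\<And>x. norm (K x) \<le> L"
    using continuous_compact_support_bounded[OF cont supp] by blast
  have "((\<lambda>\<epsilon>. \<bar>Y \<epsilon>\<bar>) \<longlongrightarrow> \<bar>q * s\<bar>) (at_right 0)"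
    by (intro tendsto_intros Y_lim)
  moreover have "q / 2 < \<bar>q * s\<bar>"
    using q s2 by (simp add: abs_mult)
  ultimately have "\<forall>\<^sub>F \<epsilon> in at_right 0. q / 2 < \<bar>Y \<epsilon>\<bar>"
    by (rule order_tendstoD)
  \<comment> \<open>Since \<bar>sinh x\<bar> \<ge> \<bar>x\<bar>, \<open>X\<close> is at least q
    \<bar>v\<bar> in modulus, and eventually q / 2 < \<bar>Y\<bar> \<le> q. Hence Y / (X^2 + Y^2) is
    at most 4 / (q (1 + v^2)) in modulus. The growth of \<open>h\<close> for \<open>DN\<close> is
    harmless because \<open>K\<close> vanishes beyond \<open>B\<close>.\<close>
  then have bound: "\<forall>\<^sub>F \<epsilon> in at_right 0. AE v in lborel.
      norm (w \<epsilon> v) \<le> cosh (q * B) * L * (4 / q) * inverse (1 + v\<^sup>2)"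
    using small
  proof (eventually_elim, intro AE_I2)
    fix \<epsilon> v assume Y: "q / 2 < \<bar>Y \<epsilon>\<bar>" and \<epsilon>: "0 < \<epsilon> \<and> sin (q * (s * \<epsilon>)) \<noteq> 0"
    have HK: "\<bar>h (q * (\<epsilon> * v)) (q * (s * \<epsilon>))\<bar> * norm (K (\<epsilon> * v)) \<le> cosh (q * B) * L"
    proof (cases "\<bar>\<epsilon> * v\<bar> > B")
      case True
      then show ?thesis using supp[OF True] L by simp
    next
      case False
      have "cosh (q * (\<epsilon> * v)) = cosh (q * \<bar>\<epsilon> * v\<bar>)"
        using cosh_real_abs[of "q * (\<epsilon> * v)"] q by (simp add: abs_mult)
      also have "\<dots> \<le> cosh (q * B)"
        using False q by (subst cosh_real_nonneg_le_iff) auto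
      finally have "cosh (q * (\<epsilon> * v)) \<le> cosh (q * B)" .
      moreover have "\<bar>cos y\<bar> \<le> cosh (q * B)" for y
        using abs_cos_le_one[of y] cosh_real_ge_1[of "q * B"] by linarith
      ultimately have "\<bar>h (q * (\<epsilon> * v)) (q * (s * \<epsilon>))\<bar> \<le> cosh (q * B)"
        by (simp add: h_def)
      then show ?thesis
        by (intro mult_mono L) auto
    qed
    have "\<bar>q * (\<epsilon> * v)\<bar> \<le> \<bar>sinh (q * (\<epsilon> * v))\<bar>"
      by (rule abs_le_abs_sinh)
    then have "\<bar>q * v\<bar> \<le> \<bar>X \<epsilon> v\<bar>"
      using \<epsilon> by (simp add: X_def abs_mult field_simps)
    then have "(q * v)\<^sup>2 \<le> (X \<epsilon> v)\<^sup>2"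
      by (simp only: abs_le_square_iff)
    moreover have "(q / 2)\<^sup>2 \<le> (Y \<epsilon>)\<^sup>2"
      using Y q by (subst abs_le_square_iff[symmetric]) simp
    moreover have "q * (q / 4 * (1 + v\<^sup>2)) = (q * v)\<^sup>2 / 4 + (q / 2)\<^sup>2"
      by (simp add: power_mult_distrib power_divide) (simp add: power2_eq_square algebra_simps)
    moreover have "0 \<le> (q * v)\<^sup>2"
      by simp
    ultimately have XY: "q * (q / 4 * (1 + v\<^sup>2)) \<le> (X \<epsilon> v)\<^sup>2 + (Y \<epsilon>)\<^sup>2"
      by linarith
    have "\<bar>sin (q * (s * \<epsilon>))\<bar> \<le> q * \<epsilon>"
      using abs_sin_x_le_abs_x[of "q * (s * \<epsilon>)"] q \<epsilon> s2 by (simp add: abs_mult)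
    then have Yq: "\<bar>Y \<epsilon>\<bar> \<le> q"
      using \<epsilon> by (simp add: Y_def field_simps)
    have "\<bar>Y \<epsilon> / ((X \<epsilon> v)\<^sup>2 + (Y \<epsilon>)\<^sup>2)\<bar> \<le> q / (q * (q / 4 * (1 + v\<^sup>2)))"
      unfolding abs_divide using XY Yq q
      by (intro frac_le) (auto intro!: mult_pos_pos simp: add_pos_nonneg)
    also have "\<dots> = 4 / q * inverse (1 + v\<^sup>2)"
      using q by (simp add: inverse_eq_divide)
    finally have "\<bar>h (q * (\<epsilon> * v)) (q * (s * \<epsilon>))\<bar> * norm (K (\<epsilon> * v)) * \<bar>Y \<epsilon> / ((X \<epsilon> v)\<^sup>2 + (Y \<epsilon>)\<^sup>2)\<bar>
        \<le> cosh (q * B) * L * (4 / q * inverse (1 + v\<^sup>2))"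
      using L by (intro mult_mono HK) auto
    moreover have "norm (w \<epsilon> v) =
        \<bar>h (q * (\<epsilon> * v)) (q * (s * \<epsilon>))\<bar> * norm (K (\<epsilon> * v)) * \<bar>Y \<epsilon> / ((X \<epsilon> v)\<^sup>2 + (Y \<epsilon>)\<^sup>2)\<bar>"
      unfolding wXY[OF conjunct1[OF \<epsilon>]] norm_mult norm_of_real abs_mult by (simp only: ac_simps)
    ultimately show "norm (w \<epsilon> v) \<le> cosh (q * B) * L * (4 / q) * inverse (1 + v\<^sup>2)"
      by (simp only: mult.assoc)
  qed
  have "((\<lambda>\<epsilon>. LINT v|lborel. w \<epsilon> v) \<longlongrightarrow> (LINT v|lborel. of_real (s / q * inverse (1 + v\<^sup>2)) * K 0)) (at_right 0)"
  proof (rule dominated_convergence_at_right_0[OF _ _ _ AE_I2[OF w_lim] bound])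
    show "w \<epsilon> \<in> borel_measurable lborel" for \<epsilon>
      unfolding w_def k_def h_def by measurable
    show "integrable lborel (\<lambda>v. cosh (q * B) * L * (4 / q) * inverse (1 + v\<^sup>2))"
      by (intro integrable_mult_right integrable_inverse_1_plus_sq)
  qed measurable
  also have "(LINT v|lborel. of_real (s / q * inverse (1 + v\<^sup>2)) * K 0) = of_real (s * pi / q) * K 0"
  proof -
    have "(LINT v|lborel. of_real (s / q * inverse (1 + v\<^sup>2)) * K 0) = of_real (LINT v|lborel. s / q * inverse (1 + v\<^sup>2)) * K 0"
      by (simp only: integral_mult_left_zero integral_complex_of_real)
    also have "(LINT v|lborel. s / q * inverse (1 + v\<^sup>2)) = s / q * pi"
      by (simp only: integral_mult_right_zero integral_inverse_1_plus_sq)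
    finally show ?thesis by simp
  qed
  finally have "((\<lambda>\<epsilon>. - \<i> * (LINT v|lborel. w \<epsilon> v)) \<longlongrightarrow> - \<i> * (of_real (s * pi / q) * K 0)) (at_right 0)"
    by (rule tendsto_mult[OF tendsto_const])
  then have "((\<lambda>\<epsilon>. LINT \<beta>|lborel. edge_kernel b (q * \<beta>) (q * (s * \<epsilon>)) * K \<beta>)
    \<longlongrightarrow> - \<i> * (of_real (s * pi / q) * K 0)) (at_right 0)"
    by (rule Lim_transform_eventually) (use small in \<open>eventually_elim, simp add: rescale\<close>)
  then show ?thesis by (simp add: mult.assoc)
qed

subsection \<open>The diffracted wave and its jumps\<close>

lemma edge_kernel_tendsto:
  fixes y :: "real \<Rightarrow> real"
  assumes "(y \<longlongrightarrow> y0) F" "sin y0 \<noteq> 0"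
  shows "((\<lambda>\<epsilon>. edge_kernel b x (y \<epsilon>)) \<longlongrightarrow> edge_kernel b x y0) F"
proof (rule continuous_on_tendsto_compose[where s = "{y. sin y \<noteq> 0}" and f = "edge_kernel b x"])
  show "continuous_on {y. sin y \<noteq> 0} (edge_kernel b x)"
    by (intro continuous_intros) auto
  have "((\<lambda>\<epsilon>. sin (y \<epsilon>)) \<longlongrightarrow> sin y0) F"
    by (intro tendsto_intros assms)
  then show "\<forall>\<^sub>F \<epsilon> in F. y \<epsilon> \<in> {y. sin y \<noteq> 0}"
    using assms(2) by (auto elim!: tendsto_imp_eventually_ne)
qed (use assms in auto)

text \<open>Off the poles \<bar>sin\<bar> eventually exceeds half its limit, so the kernel is
  uniformly bounded and a multiple of \<open>norm (K \<beta>)\<close> dominates. This treats the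
  translates that have no pole on the ray in question.\<close>

lemma edge_kernel_integral_tendsto:
  fixes y :: "real \<Rightarrow> real" and K :: "real \<Rightarrow> complex"
  assumes y: "(y \<longlongrightarrow> y0) (at_right 0)" "sin y0 \<noteq> 0" and K: "integrable lborel K"
  shows "((\<lambda>\<epsilon>. LINT \<beta>|lborel. edge_kernel b (q * \<beta>) (y \<epsilon>) * K \<beta>)
    \<longlongrightarrow> (LINT \<beta>|lborel. edge_kernel b (q * \<beta>) y0 * K \<beta>)) (at_right 0)"
proof (rule dominated_convergence_at_right_0[where
      s = "\<lambda>\<epsilon> \<beta>. edge_kernel b (q * \<beta>) (y \<epsilon>) * K \<beta>" and w = "\<lambda>\<beta>. 2 / \<bar>sin y0\<bar> * norm (K \<beta>)"])
  have [measurable]: "K \<in> borel_measurable borel"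
    using K by auto
  show "(\<lambda>\<beta>. edge_kernel b (q * \<beta>) y0 * K \<beta>) \<in> borel_measurable lborel"
    "(\<lambda>\<beta>. edge_kernel b (q * \<beta>) (y \<epsilon>) * K \<beta>) \<in> borel_measurable lborel" for \<epsilon>
    by measurable
  show "integrable lborel (\<lambda>\<beta>. 2 / \<bar>sin y0\<bar> * norm (K \<beta>))"
    using K by simp
  show "AE \<beta> in lborel. ((\<lambda>\<epsilon>. edge_kernel b (q * \<beta>) (y \<epsilon>) * K \<beta>)
      \<longlongrightarrow> edge_kernel b (q * \<beta>) y0 * K \<beta>) (at_right 0)"
    by (intro AE_I2 tendsto_intros edge_kernel_tendsto y)
  have "((\<lambda>\<epsilon>. \<bar>sin (y \<epsilon>)\<bar>) \<longlongrightarrow> \<bar>sin y0\<bar>) (at_right 0)"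
    by (intro tendsto_intros y)
  moreover have "\<bar>sin y0\<bar> / 2 < \<bar>sin y0\<bar>"
    using y(2) by simp
  ultimately have "\<forall>\<^sub>F \<epsilon> in at_right 0. \<bar>sin y0\<bar> / 2 < \<bar>sin (y \<epsilon>)\<bar>"
    by (rule order_tendstoD)
  then show "\<forall>\<^sub>F \<epsilon> in at_right 0. AE \<beta> in lborel. norm (edge_kernel b (q * \<beta>) (y \<epsilon>) * K \<beta>)
      \<le> 2 / \<bar>sin y0\<bar> * norm (K \<beta>)"
  proof (eventually_elim, intro AE_I2)
    fix \<epsilon> \<beta> assume *: "\<bar>sin y0\<bar> / 2 < \<bar>sin (y \<epsilon>)\<bar>"
    then have "norm (edge_kernel b (q * \<beta>) (y \<epsilon>)) \<le> 1 / (\<bar>sin (y \<epsilon>)\<bar> * cosh (q * \<beta>))"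
      by (intro norm_edge_kernel_le) auto
    also have "\<dots> \<le> 1 / (\<bar>sin y0\<bar> / 2 * 1)"
      using * y(2) cosh_real_ge_1[of "q * \<beta>"]
      by (intro divide_left_mono mult_mono) (auto intro!: mult_pos_pos)
    finally show "norm (edge_kernel b (q * \<beta>) (y \<epsilon>) * K \<beta>) \<le> 2 / \<bar>sin y0\<bar> * norm (K \<beta>)"
      unfolding norm_mult by (intro mult_right_mono) auto
  qed
qed

lemma test_function_continuous_bounded_support:
  assumes "\<psi> \<in> test_functions"
  obtains A where "A > 0" "\<And>t. \<bar>t\<bar> > A \<Longrightarrow> \<psi> t = 0" "continuous_on UNIV \<psi>"
proof -
  have "compact (closure {t. \<psi> t \<noteq> 0})" and "\<And>n t. ((\<lambda>f y. vector_derivative f (at y)) ^^ n) \<psi> differentiable (at t)"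
    using assms by (auto simp: test_functions_def)
  from this(2)[of 0] have "continuous_on UNIV \<psi>"
    by (simp add: continuous_at_imp_continuous_on differentiable_imp_continuous_within)
  have "bounded {t. \<psi> t \<noteq> 0}"
    by (rule bounded_subset[OF compact_imp_bounded[OF \<open>compact _\<close>] closure_subset])
  then obtain A where "A > 0" "\<And>t. \<psi> t \<noteq> 0 \<Longrightarrow> \<bar>t\<bar> \<le> A"
    unfolding bounded_pos by auto
  then show thesis
    using that[of A] \<open>continuous_on UNIV \<psi>\<close> by (meson not_less)
qed

lemma norm_jump_sign [simp]: "norm (jump_sign b k) = 1"
  by (auto simp: jump_sign_def split: boundary_type.split)

text \<open>\<open>jump_tendsto\<close> only asserts the existence of some \<open>J\<close>. Limits
  determine it on test functions, and its values elsewhere are arbitrary.\<close>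

lemma jump_distribution_unique:
  assumes "jump_distribution b \<phi> \<alpha> F k \<rho> J" "jump_distribution b \<phi> \<alpha> F k \<rho> J'" "\<psi> \<in> test_functions"
  shows "J \<psi> = J' \<psi>"
proof -
  have unique: "T \<psi> = T' \<psi>" if "distribution_tendsto f T (at_right 0)" "distribution_tendsto f T' (at_right 0)"
    for f :: "real \<Rightarrow> real \<Rightarrow> complex" and T T'
    using that assms(3) unfolding distribution_tendsto_def
    by (blast intro: tendsto_unique[OF trivial_limit_at_right_real])
  obtain Tp Tm where T: "distribution_tendsto (\<lambda>\<epsilon>. diffracted_wave b \<phi> \<alpha> F \<rho> (critical_angle \<phi> \<alpha> k + \<epsilon>)) Tp (at_right 0)"
      "distribution_tendsto (\<lambda>\<epsilon>. diffracted_wave b \<phi> \<alpha> F \<rho> (critical_angle \<phi> \<alpha> k - \<epsilon>)) Tm (at_right 0)"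
      "J = (\<lambda>\<psi>. Tp \<psi> - Tm \<psi>)"
    using assms(1) unfolding jump_distribution_def by (elim exE conjE)
  obtain Tp' Tm' where T': "distribution_tendsto (\<lambda>\<epsilon>. diffracted_wave b \<phi> \<alpha> F \<rho> (critical_angle \<phi> \<alpha> k + \<epsilon>)) Tp' (at_right 0)"
      "distribution_tendsto (\<lambda>\<epsilon>. diffracted_wave b \<phi> \<alpha> F \<rho> (critical_angle \<phi> \<alpha> k - \<epsilon>)) Tm' (at_right 0)"
      "J' = (\<lambda>\<psi>. Tp' \<psi> - Tm' \<psi>)"
    using assms(2) unfolding jump_distribution_def by (elim exE conjE)
  show ?thesis
    unfolding T(3) T'(3) unique[OF T(1) T'(1)] unique[OF T(2) T'(2)] ..
qed

section \<open>The kernel on the range of angles outside the wedge\<close>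

locale wedge =
  fixes b :: boundary_type and \<phi> \<alpha> :: real
  assumes \<phi>: "0 < \<phi>" "\<phi> < pi"
    and \<alpha>: "max 0 (\<phi> - pi / 2) < \<alpha>" "\<alpha> < min (pi / 2) \<phi>"
begin

abbreviation "q \<equiv> wedge_q \<phi>"
abbreviation "crit \<equiv> critical_angle \<phi> \<alpha>"
abbreviation "Z \<theta> \<beta> \<equiv> kernel_Z b \<phi> \<alpha> (of_real \<beta> + \<i> * of_real \<theta>)"

lemma q_pos: "q > 0"
  using \<phi> by (simp add: wedge_q_def Phi_def)

lemma angle_bounds: "0 < \<alpha>" "\<phi> < \<alpha> + pi / 2" "\<alpha> < pi / 2" "\<alpha> < \<phi>"
  using \<alpha> by auto

lemma Z_eq:
  "Z \<theta> \<beta> = jump_sign b 1 * edge_kernel b (q * \<beta>) (q * (\<theta> - crit 1))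
    + jump_sign b 2 * edge_kernel b (q * \<beta>) (q * (\<theta> - crit 2))
    - edge_kernel b (q * \<beta>) (q * (\<theta> - \<alpha>)) + edge_kernel b (q * \<beta>) (q * (\<theta> - (2 * pi + \<alpha>)))"
  using \<phi> by (intro kernel_Z_decomposition) auto

lemma Z_measurable [measurable]: "(\<lambda>\<beta>. Z \<theta> \<beta>) \<in> borel_measurable borel"
  unfolding Z_eq by measurable

text \<open>2 \<Phi> equals \<pi> / q, and every pole angle lies at distance less than 2 \<Phi> from
  the whole range of \<theta>, so the argument of the sine stays in (-\<pi>, \<pi>). Excluding only
  \<theta> = a lets a critical angle itself be inserted for \<theta> in the three translates that
  are regular there.\<close>

lemma sin_nonzero:
  assumes "\<phi> \<le> \<theta>" "\<theta> \<le> 2 * pi" "a \<in> {crit 1, crit 2, \<alpha>, 2 * pi + \<alpha>}" "\<theta> \<noteq> a"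
  shows "sin (q * (\<theta> - a)) \<noteq> 0"
proof -
  have q: "q * (2 * (2 * pi - \<phi>)) = pi"
    using \<phi> by (simp add: wedge_q_def Phi_def)
  have "a = 2 * \<phi> - \<alpha> \<or> a = 2 * pi - \<alpha> \<or> a = \<alpha> \<or> a = 2 * pi + \<alpha>"
    using assms(3) by (auto simp: critical_angle_def)
  then have "\<bar>\<theta> - a\<bar> < 2 * (2 * pi - \<phi>)"
    using assms(1,2) \<phi> angle_bounds by (smt (verit))
  from mult_strict_left_mono[OF this q_pos] have "q * \<bar>\<theta> - a\<bar> < pi"
    unfolding q .
  moreover have "0 < q * \<bar>\<theta> - a\<bar>"
    using assms q_pos by simp
  ultimately have "sin (q * \<bar>\<theta> - a\<bar>) > 0"
    by (intro sin_gt_zero)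
  moreover have "q * (\<theta> - a) = q * \<bar>\<theta> - a\<bar> \<or> q * (\<theta> - a) = - (q * \<bar>\<theta> - a\<bar>)"
    by (cases "\<theta> \<ge> a") (simp_all add: abs_if flip: mult_minus_right)
  ultimately show ?thesis
    by (metis less_irrefl neg_equal_0_iff_equal sin_minus)
qed

lemma regular_sin_nonzero:
  assumes "\<theta> \<in> regular_angles \<phi> \<alpha>" "a \<in> {crit 1, crit 2, \<alpha>, 2 * pi + \<alpha>}"
  shows "sin (q * (\<theta> - a)) \<noteq> 0"
proof (rule sin_nonzero)
  show "\<theta> \<noteq> a"
    using assms \<phi> angle_bounds by (auto simp: regular_angles_def)
qed (use assms in \<open>auto simp: regular_angles_def\<close>)

text \<open>The decaying bound yields integrability in \<beta> for the long time limit; the constant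
  one serves Fubini's theorem on a bounded rectangle.\<close>

lemma Z_bound:
  assumes "\<theta> \<in> regular_angles \<phi> \<alpha>"
  obtains L where "L \<ge> 0" "\<And>\<beta>. norm (Z \<theta> \<beta>) \<le> L * (1 / cosh (q * \<beta>))" "\<And>\<beta>. norm (Z \<theta> \<beta>) \<le> L"
proof -
  define L where "L = 1 / \<bar>sin (q * (\<theta> - crit 1))\<bar> + 1 / \<bar>sin (q * (\<theta> - crit 2))\<bar>
    + 1 / \<bar>sin (q * (\<theta> - \<alpha>))\<bar> + 1 / \<bar>sin (q * (\<theta> - (2 * pi + \<alpha>)))\<bar>"
  have L: "L \<ge> 0"
    unfolding L_def by (intro add_nonneg_nonneg) auto
  have e: "norm (edge_kernel b (q * \<beta>) (q * (\<theta> - a))) \<le> 1 / \<bar>sin (q * (\<theta> - a))\<bar> * (1 / cosh (q * \<beta>))"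
    if "a \<in> {crit 1, crit 2, \<alpha>, 2 * pi + \<alpha>}" for a \<beta>
    using norm_edge_kernel_le[OF regular_sin_nonzero[OF assms that], of b "q * \<beta>"]
    unfolding times_divide_times_eq mult_1_left .
  have norm4: "norm (u + v - w + z) \<le> norm u + norm v + norm w + norm z" for u v w z :: complex
    using norm_triangle_ineq[of "u + v - w" z] norm_triangle_ineq4[of "u + v" w] norm_triangle_ineq[of u v]
    by linarith
  have Z: "norm (Z \<theta> \<beta>) \<le> L * (1 / cosh (q * \<beta>))" for \<beta>
  proof -
    have "norm (Z \<theta> \<beta>) \<le> norm (edge_kernel b (q * \<beta>) (q * (\<theta> - crit 1)))
        + norm (edge_kernel b (q * \<beta>) (q * (\<theta> - crit 2))) + norm (edge_kernel b (q * \<beta>) (q * (\<theta> - \<alpha>)))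
        + norm (edge_kernel b (q * \<beta>) (q * (\<theta> - (2 * pi + \<alpha>))))"
      unfolding Z_eq using norm4[of "jump_sign b 1 * edge_kernel b (q * \<beta>) (q * (\<theta> - crit 1))"
          "jump_sign b 2 * edge_kernel b (q * \<beta>) (q * (\<theta> - crit 2))"
          "edge_kernel b (q * \<beta>) (q * (\<theta> - \<alpha>))" "edge_kernel b (q * \<beta>) (q * (\<theta> - (2 * pi + \<alpha>)))"]
      unfolding norm_mult norm_jump_sign mult_1_left .
    also have "\<dots> \<le> L * (1 / cosh (q * \<beta>))"
      unfolding L_def distrib_right by (intro add_mono e) auto
    finally show ?thesis .
  qed
  have Z': "norm (Z \<theta> \<beta>) \<le> L" for \<beta>
  proof -
    have "L * (1 / cosh (q * \<beta>)) \<le> L * 1"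
      using L cosh_real_ge_1[of "q * \<beta>"] by (intro mult_left_mono) auto
    then show ?thesis using Z[of \<beta>] by simp
  qed
  show thesis
    by (rule that[OF L Z Z'])
qed

lemma Z_integrable:
  assumes "\<theta> \<in> regular_angles \<phi> \<alpha>"
  shows "integrable lborel (\<lambda>\<beta>. norm (Z \<theta> \<beta>))"
proof -
  obtain L where L: "L \<ge> 0" "\<And>\<beta>. norm (Z \<theta> \<beta>) \<le> L * (1 / cosh (q * \<beta>))"
    by (rule Z_bound[OF assms]) blast
  show ?thesis
  proof (rule Bochner_Integration.integrable_bound)
    show "integrable lborel (\<lambda>\<beta>. L * (1 / cosh (q * \<beta>)))"
      by (intro integrable_mult_right integrable_inverse_cosh q_pos)
    show "AE \<beta> in lborel. norm (norm (Z \<theta> \<beta>)) \<le> norm (L * (1 / cosh (q * \<beta>)))"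
      using L by (intro AE_I2) (simp add: abs_mult)
  qed measurable
qed

text \<open>From 0 < \<alpha> < \<phi> < \<pi> both critical rays lie strictly inside the range of
  angles and are distinct, so a small neighbourhood of one stays in the range and misses the
  other.\<close>

lemma critical_angle_neighbourhood:
  assumes "k \<in> {1, 2}" "s \<in> {1, -1}"
  shows "\<forall>\<^sub>F \<epsilon> in at_right 0. crit k + s * \<epsilon> \<in> regular_angles \<phi> \<alpha>"
  unfolding eventually_at_right_field
proof (intro exI conjI allI impI)
  show "0 < min (min (crit k - \<phi>) (2 * pi - crit k)) (crit 2 - crit 1)"
    using assms \<phi> angle_bounds by (auto simp: critical_angle_def)
  fix \<epsilon> assume "0 < \<epsilon>" "\<epsilon> < min (min (crit k - \<phi>) (2 * pi - crit k)) (crit 2 - crit 1)"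
  then show "crit k + s * \<epsilon> \<in> regular_angles \<phi> \<alpha>"
    using assms by (auto simp: regular_angles_def)
qed

end

section \<open>The wave expressed by the Borel representative \<open>P\<close>\<close>

locale wedge_profile = wedge +
  fixes F P :: "real \<Rightarrow> complex" and M :: real and m :: nat
  assumes P_measurable [measurable]: "P \<in> borel_measurable borel"
    and F_eq_P: "AE s in lebesgue. F s = P s"
    and P_causal: "\<And>s. s < 0 \<Longrightarrow> P s = 0"
    and P_growth: "\<And>s. norm (P s) \<le> M * (1 + \<bar>s\<bar>) ^ m"
begin

lemma M_nonneg: "M \<ge> 0"
  using order.trans[OF norm_ge_zero P_growth[of 0]] by simp

text \<open>Causality turns polynomial growth into a uniform bound on each half-line extending to
  the left. This suits the wave, since t - \<rho> cosh \<beta> never exceeds t.\<close>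

lemma P_bounded: "s \<le> A \<Longrightarrow> A \<ge> 0 \<Longrightarrow> norm (P s) \<le> M * (1 + A) ^ m"
proof (cases "s < 0")
  case False
  assume "s \<le> A" "A \<ge> 0"
  then have "M * (1 + \<bar>s\<bar>) ^ m \<le> M * (1 + A) ^ m"
    using False M_nonneg by (intro mult_left_mono power_mono) auto
  then show ?thesis using P_growth[of s] by linarith
qed (use P_causal M_nonneg in auto)

lemma cosh_measurable [measurable]: "cosh \<in> borel_measurable (borel :: real measure)"
  by (auto intro!: borel_measurable_continuous_onI continuous_intros)

lemma diffracted_wave_eq:
  assumes "\<rho> > 0"
  shows "diffracted_wave b \<phi> \<alpha> F \<rho> \<theta> t =
    \<i> / (4 * of_real (Phi \<phi>)) * (LINT \<beta>|lborel. Z \<theta> \<beta> * P (t - \<rho> * cosh \<beta>))"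
proof -
  have "AE \<beta> in lebesgue. Z \<theta> \<beta> * F (t - \<rho> * cosh \<beta>) = Z \<theta> \<beta> * P (t - \<rho> * cosh \<beta>)"
    using AE_comp_affine_cosh[OF F_eq_P assms, of t] by eventually_elim simp
  moreover have "(\<lambda>\<beta>. Z \<theta> \<beta> * P (t - \<rho> * cosh \<beta>)) \<in> borel_measurable lborel"
    by measurable
  ultimately show ?thesis
    unfolding diffracted_wave_def by (simp only: AE_lebesgue_borel_measurable(2))
qed

lemma diffracted_wave_tendsto:
  assumes lim: "(P \<longlongrightarrow> C) at_top" and "\<rho> > 0" and \<theta>: "\<theta> \<in> regular_angles \<phi> \<alpha>"
  shows "((\<lambda>t. diffracted_wave b \<phi> \<alpha> F \<rho> \<theta> t) \<longlongrightarrow> diffracted_wave_limit b \<phi> \<alpha> C \<theta>) at_top"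
proof -
  have "\<forall>\<^sub>F s in at_top. norm (P s) < norm C + 1"
    using tendsto_norm[OF lim] by (rule order_tendstoD) simp
  then obtain S where S: "\<And>s. s \<ge> S \<Longrightarrow> norm (P s) \<le> norm C + 1"
    unfolding eventually_at_top_linorder by (meson less_imp_le)
  \<comment> \<open>Beyond \<open>S\<close> the limit bounds \<open>P\<close>; to the left of it
    causality and growth do. So \<open>P\<close> is bounded on the whole line and \<open>L\<close>
    times the norm of Z dominates for all times at once.\<close>
  define L where "L = max (norm C + 1) (M * (1 + max 0 S) ^ m)"
  have L: "norm (P s) \<le> L" for s
    using S[of s] P_bounded[of s "max 0 S"] unfolding L_def by (cases "s \<ge> S") (auto simp: le_max_iff_disj)
  have "((\<lambda>t. LINT \<beta>|lborel. Z \<theta> \<beta> * P (t - \<rho> * cosh \<beta>)) \<longlongrightarrow> (LINT \<beta>|lborel. Z \<theta> \<beta> * C)) at_top"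
  proof (rule integral_dominated_convergence_at_top)
    show "integrable lborel (\<lambda>\<beta>. norm (Z \<theta> \<beta>) * L)"
      by (intro integrable_mult_left Z_integrable \<theta>)
    show "\<forall>\<^sub>F t in at_top. AE \<beta> in lborel. norm (Z \<theta> \<beta> * P (t - \<rho> * cosh \<beta>)) \<le> norm (Z \<theta> \<beta>) * L"
      unfolding norm_mult by (intro always_eventually allI AE_I2 mult_left_mono L) auto
    have "filterlim (\<lambda>t. t - \<rho> * cosh \<beta>) at_top at_top" for \<beta>
      using filterlim_tendsto_add_at_top[OF tendsto_const[of "- (\<rho> * cosh \<beta>)"] filterlim_ident] by simp
    then show "AE \<beta> in lborel. ((\<lambda>t. Z \<theta> \<beta> * P (t - \<rho> * cosh \<beta>)) \<longlongrightarrow> Z \<theta> \<beta> * C) at_top"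
      by (intro AE_I2 tendsto_intros filterlim_compose[OF lim])
  qed measurable
  then have "((\<lambda>t. diffracted_wave b \<phi> \<alpha> F \<rho> \<theta> t) \<longlongrightarrow>
      \<i> / (4 * of_real (Phi \<phi>)) * (LINT \<beta>|lborel. Z \<theta> \<beta> * C)) at_top"
    unfolding diffracted_wave_eq[OF \<open>\<rho> > 0\<close>] by (intro tendsto_intros)
  also have "(LINT \<beta>|lborel. Z \<theta> \<beta> * C) = (LINT \<beta>|lebesgue. Z \<theta> \<beta>) * C"
    by (simp add: integral_completion)
  finally show ?thesis
    by (simp add: diffracted_wave_limit_def mult_ac)
qed

section \<open>Testing in time; \<open>tested_profile\<close> is the K of the overview\<close>

definition tested_profile :: "real \<Rightarrow> (real \<Rightarrow> complex) \<Rightarrow> real \<Rightarrow> complex" where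
  "tested_profile \<rho> \<psi> \<beta> = (LINT t|lborel. P (t - \<rho> * cosh \<beta>) * \<psi> t)"

lemma tested_profile_even: "tested_profile \<rho> \<psi> (- \<beta>) = tested_profile \<rho> \<psi> \<beta>"
  by (simp add: tested_profile_def)

text \<open>As cosh \<beta> \<ge> \<bar>\<beta>\<bar>, the delay \<rho> cosh \<beta> exceeds
  \<open>A\<close> and the argument of \<open>P\<close> becomes negative.\<close>

lemma profile_vanishes:
  assumes "\<rho> > 0" "t \<le> A" "\<bar>\<beta>\<bar> > A / \<rho>"
  shows "P (t - \<rho> * cosh \<beta>) = 0"
proof (rule P_causal)
  have "A < \<rho> * \<bar>\<beta>\<bar>"
    using assms by (simp add: field_simps)
  also have "\<dots> \<le> \<rho> * cosh \<beta>"
    using assms abs_le_cosh by (intro mult_left_mono) auto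
  finally show "t - \<rho> * cosh \<beta> < 0"
    using assms by simp
qed

lemma tested_profile_support:
  assumes "\<rho> > 0" "\<And>t. \<bar>t\<bar> > A \<Longrightarrow> \<psi> t = 0" "\<bar>\<beta>\<bar> > A / \<rho>"
  shows "tested_profile \<rho> \<psi> \<beta> = 0"
proof -
  have "P (t - \<rho> * cosh \<beta>) * \<psi> t = 0" for t
    using profile_vanishes[OF assms(1) _ assms(3), of t] assms(2)[of t] by (cases "t \<le> A") auto
  then show ?thesis
    unfolding tested_profile_def by (simp only: integral_zero)
qed

text \<open>\<open>P\<close> may be discontinuous, so the shift t = s + \<rho> cosh \<beta> moves
  the dependence on \<beta> onto the continuous \<psi>. The integrand then lives on [0, A] for every
  \<beta>: \<open>P\<close> vanishes to the left, and \<psi> to the right because the shift is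
  positive.\<close>

lemma tested_profile_continuous:
  assumes "\<rho> > 0" and \<psi>: "\<psi> \<in> test_functions"
  shows "continuous_on UNIV (tested_profile \<rho> \<psi>)"
proof (rule continuous_on_sequentiallyI)
  obtain A where A: "A > 0" "\<And>t. \<bar>t\<bar> > A \<Longrightarrow> \<psi> t = 0" "continuous_on UNIV \<psi>"
    by (rule test_function_continuous_bounded_support[OF \<psi>]) blast
  obtain L where L: "L \<ge> 0" "\<And>t. norm (\<psi> t) \<le> L"
    using continuous_compact_support_bounded[OF A(3,2)] by blast
  have [measurable]: "\<psi> \<in> borel_measurable borel"
    using A(3) by (rule borel_measurable_continuous_onI)
  have shifted: "tested_profile \<rho> \<psi> \<beta> = (LINT s|lborel. P s * \<psi> (\<rho> * cosh \<beta> + s))" for \<beta>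
    unfolding tested_profile_def
    using lborel_integral_real_affine[of 1 "\<lambda>t. P (t - \<rho> * cosh \<beta>) * \<psi> t" "\<rho> * cosh \<beta>"] by simp
  fix u :: "nat \<Rightarrow> real" and a assume u: "u \<longlonglongrightarrow> a"
  show "(\<lambda>n. tested_profile \<rho> \<psi> (u n)) \<longlonglongrightarrow> tested_profile \<rho> \<psi> a"
    unfolding shifted
  proof (rule integral_dominated_convergence)
    show "integrable lborel (\<lambda>s. M * (1 + A) ^ m * L * indicator {0..A} s)"
      by (intro integrable_mult_right integrable_real_indicator) (use A(1) in auto)
    show "AE s in lborel. norm (P s * \<psi> (\<rho> * cosh (u n) + s)) \<le> M * (1 + A) ^ m * L * indicator {0..A} s" for n
    proof (rule AE_I2)
      fix s
      show "norm (P s * \<psi> (\<rho> * cosh (u n) + s)) \<le> M * (1 + A) ^ m * L * indicator {0..A} s"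
      proof (cases "s \<in> {0..A}")
        case True
        then show ?thesis
          using L P_bounded[of s A] M_nonneg by (simp add: norm_mult mult_mono)
      next
        case False
        have "\<rho> * cosh (u n) > 0"
          using assms(1) by simp
        then have "P s = 0 \<or> \<psi> (\<rho> * cosh (u n) + s) = 0"
          using False P_causal[of s] A(2)[of "\<rho> * cosh (u n) + s"] by (cases "s < 0") auto
        then show ?thesis using False by auto
      qed
    qed
    show "AE s in lborel. (\<lambda>n. P s * \<psi> (\<rho> * cosh (u n) + s)) \<longlonglongrightarrow> P s * \<psi> (\<rho> * cosh a + s)"
      by (intro AE_I2 tendsto_intros continuous_on_tendsto_compose[OF A(3)] u) auto
  qed measurable
qed

text \<open>Fubini's theorem applies because the integrand vanishes outside the rectangle
  \<bar>t\<bar> \<le> A, \<bar>\<beta>\<bar> \<le> A / \<rho> and is bounded on it.\<close>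

lemma regular_distribution_diffracted_wave:
  assumes "\<rho> > 0" and \<theta>: "\<theta> \<in> regular_angles \<phi> \<alpha>" and \<psi>: "\<psi> \<in> test_functions"
  shows "regular_distribution (diffracted_wave b \<phi> \<alpha> F \<rho> \<theta>) \<psi> =
    \<i> / (4 * of_real (Phi \<phi>)) * (LINT \<beta>|lborel. Z \<theta> \<beta> * tested_profile \<rho> \<psi> \<beta>)"
proof -
  obtain A where A: "A > 0" "\<And>t. \<bar>t\<bar> > A \<Longrightarrow> \<psi> t = 0" "continuous_on UNIV \<psi>"
    by (rule test_function_continuous_bounded_support[OF \<psi>]) blast
  obtain L where L: "L \<ge> 0" "\<And>t. norm (\<psi> t) \<le> L"
    using continuous_compact_support_bounded[OF A(3,2)] by blast
  obtain N where N: "N \<ge> 0" "\<And>\<beta>. norm (Z \<theta> \<beta>) \<le> N"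
    by (rule Z_bound[OF \<theta>]) blast
  have [measurable]: "\<psi> \<in> borel_measurable borel"
    using A(3) by (rule borel_measurable_continuous_onI)
  define f where "f t \<beta> = Z \<theta> \<beta> * P (t - \<rho> * cosh \<beta>) * \<psi> t" for t \<beta>
  have int: "integrable (lborel \<Otimes>\<^sub>M lborel) (case_prod f)"
  proof (rule integrableI_bounded_set)
    show "{-A..A} \<times> {- (A / \<rho>)..A / \<rho>} \<in> sets (lborel \<Otimes>\<^sub>M lborel)"
      by simp
    show "emeasure (lborel \<Otimes>\<^sub>M lborel) ({-A..A} \<times> {- (A / \<rho>)..A / \<rho>}) < \<infinity>"
      using A(1) assms(1)
      by (subst lborel.emeasure_pair_measure_Times) (auto simp: ennreal_mult_less_top)
    have "f t \<beta> = 0" if "(t, \<beta>) \<notin> {-A..A} \<times> {- (A / \<rho>)..A / \<rho>}" for t \<beta>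
      using profile_vanishes[OF assms(1), of t A \<beta>] A(2)[of t] that unfolding f_def
      by (cases "\<bar>t\<bar> > A") (auto simp: abs_le_iff not_less)
    then show "AE x in lborel \<Otimes>\<^sub>M lborel. x \<notin> {-A..A} \<times> {- (A / \<rho>)..A / \<rho>} \<longrightarrow> case_prod f x = 0"
      by (intro AE_I2 impI) (metis case_prod_beta prod.collapse)
    have "norm (f t \<beta>) \<le> N * (M * (1 + A) ^ m) * L" if "t \<in> {-A..A}" for t \<beta>
    proof -
      have "0 < \<rho> * cosh \<beta>" using assms(1) by simp
      then have "t - \<rho> * cosh \<beta> \<le> A"
        using that by auto
      then have "norm (P (t - \<rho> * cosh \<beta>)) \<le> M * (1 + A) ^ m"
        using A(1) by (intro P_bounded) auto
      then show ?thesis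
        unfolding f_def norm_mult using L N M_nonneg A(1) by (intro mult_mono) auto
    qed
    then show "AE x in lborel \<Otimes>\<^sub>M lborel. x \<in> {-A..A} \<times> {- (A / \<rho>)..A / \<rho>} \<longrightarrow>
        norm (case_prod f x) \<le> N * (M * (1 + A) ^ m) * L"
      by (intro AE_I2) auto
  qed (unfold f_def, measurable)
  have "regular_distribution (diffracted_wave b \<phi> \<alpha> F \<rho> \<theta>) \<psi> =
      (LINT t|lebesgue. \<i> / (4 * of_real (Phi \<phi>)) * (LINT \<beta>|lborel. Z \<theta> \<beta> * P (t - \<rho> * cosh \<beta>)) * \<psi> t)"
    unfolding regular_distribution_def diffracted_wave_eq[OF assms(1)] ..
  also have "\<dots> = (LINT t|lborel. \<i> / (4 * of_real (Phi \<phi>)) * (LINT \<beta>|lborel. Z \<theta> \<beta> * P (t - \<rho> * cosh \<beta>)) * \<psi> t)"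
    by (rule integral_completion) measurable
  also have "\<dots> = \<i> / (4 * of_real (Phi \<phi>)) * (LINT t|lborel. (LINT \<beta>|lborel. f t \<beta>))"
    unfolding f_def integral_mult_left_zero by (simp only: mult.assoc integral_mult_right_zero)
  also have "(LINT t|lborel. (LINT \<beta>|lborel. f t \<beta>)) = (LINT \<beta>|lborel. (LINT t|lborel. f t \<beta>))"
    using lborel_pair.Fubini_integral[OF int] by simp
  also have "\<dots> = (LINT \<beta>|lborel. Z \<theta> \<beta> * tested_profile \<rho> \<psi> \<beta>)"
    unfolding f_def tested_profile_def by (simp only: integral_mult_right_zero mult.assoc)
  finally show ?thesis .
qed

section \<open>One-sided traces and the jump\<close>

definition regular_part :: "real \<Rightarrow> (real \<Rightarrow> complex) \<Rightarrow> nat \<Rightarrow> complex" where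
  "regular_part \<rho> \<psi> k =
    (let I = \<lambda>a. LINT \<beta>|lborel. edge_kernel b (q * \<beta>) (q * (crit k - a)) * tested_profile \<rho> \<psi> \<beta>
     in jump_sign b (3 - k) * I (crit (3 - k)) - I \<alpha> + I (2 * pi + \<alpha>))"

text \<open>The side \<open>s\<close> enters only through the term of the translate with its pole on
  ray \<open>k\<close>. \<open>regular_part\<close> collects the other three translates, evaluated
  on the ray itself, with \<open>3 - k\<close> denoting the other critical ray.\<close>

definition one_sided_trace :: "real \<Rightarrow> nat \<Rightarrow> real \<Rightarrow> (real \<Rightarrow> complex) \<Rightarrow> complex" where
  "one_sided_trace \<rho> k s \<psi> = \<i> / (4 * of_real (Phi \<phi>)) *
    (jump_sign b k * (- \<i> * of_real (s * pi / q) * tested_profile \<rho> \<psi> 0) + regular_part \<rho> \<psi> k)"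

lemma one_sided_trace:
  assumes "\<rho> > 0" and k: "k \<in> {1, 2}" and s: "s \<in> {1, -1}"
  shows "distribution_tendsto (\<lambda>\<epsilon>. diffracted_wave b \<phi> \<alpha> F \<rho> (crit k + s * \<epsilon>)) (one_sided_trace \<rho> k s) (at_right 0)"
  unfolding distribution_tendsto_def
proof
  fix \<psi> assume \<psi>: "\<psi> \<in> test_functions"
  obtain A where A: "A > 0" "\<And>t. \<bar>t\<bar> > A \<Longrightarrow> \<psi> t = 0" "continuous_on UNIV \<psi>"
    by (rule test_function_continuous_bounded_support[OF \<psi>]) blast
  let ?K = "tested_profile \<rho> \<psi>"
  note cont = tested_profile_continuous[OF assms(1) \<psi>]
  note supp = tested_profile_support[OF assms(1) A(2)]
  define I where "I \<theta> a = (LINT \<beta>|lborel. edge_kernel b (q * \<beta>) (q * (\<theta> - a)) * ?K \<beta>)" for \<theta> a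
  have int: "integrable lborel (\<lambda>\<beta>. edge_kernel b (q * \<beta>) (q * (\<theta> - a)) * ?K \<beta>)"
    if "\<theta> \<in> regular_angles \<phi> \<alpha>" "a \<in> {crit 1, crit 2, \<alpha>, 2 * pi + \<alpha>}" for \<theta> a
    by (rule continuous_compact_support_integrable[where B = "A / \<rho>"])
      (use regular_sin_nonzero[OF that] supp in \<open>auto intro!: continuous_intros cont\<close>)
  have split: "(LINT \<beta>|lborel. Z \<theta> \<beta> * ?K \<beta>) = jump_sign b k * I \<theta> (crit k) +
      (jump_sign b (3 - k) * I \<theta> (crit (3 - k)) - I \<theta> \<alpha> + I \<theta> (2 * pi + \<alpha>))"
    if "\<theta> \<in> regular_angles \<phi> \<alpha>" for \<theta>
  proof -
    note i = int[OF that]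
    have "(LINT \<beta>|lborel. Z \<theta> \<beta> * ?K \<beta>) = jump_sign b 1 * I \<theta> (crit 1) + jump_sign b 2 * I \<theta> (crit 2)
        - I \<theta> \<alpha> + I \<theta> (2 * pi + \<alpha>)"
      unfolding Z_eq I_def distrib_right left_diff_distrib mult.assoc
      using i[of "crit 1"] i[of "crit 2"] i[of \<alpha>] i[of "2 * pi + \<alpha>"] by simp
    then show ?thesis using k by auto
  qed
  have reg: "((\<lambda>\<epsilon>. I (crit k + s * \<epsilon>) a) \<longlongrightarrow> I (crit k) a) (at_right 0)"
    if "a \<in> {crit (3 - k), \<alpha>, 2 * pi + \<alpha>}" for a
    unfolding I_def
  proof (rule edge_kernel_integral_tendsto)
    have "((\<lambda>\<epsilon>. q * (crit k + s * \<epsilon> - a)) \<longlongrightarrow> q * (crit k + s * 0 - a)) (at_right 0)"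
      by (intro tendsto_intros)
    then show "((\<lambda>\<epsilon>. q * (crit k + s * \<epsilon> - a)) \<longlongrightarrow> q * (crit k - a)) (at_right 0)"
      by simp
    show "sin (q * (crit k - a)) \<noteq> 0"
      using that k \<phi> angle_bounds by (intro sin_nonzero) (auto simp: critical_angle_def)
    show "integrable lborel ?K"
      by (rule continuous_compact_support_integrable[OF cont supp])
  qed
  have sing: "((\<lambda>\<epsilon>. I (crit k + s * \<epsilon>) (crit k)) \<longlongrightarrow> - \<i> * of_real (s * pi / q) * ?K 0) (at_right 0)"
    unfolding I_def add_diff_cancel_left'
    by (rule edge_kernel_approximate_identity[OF q_pos s cont tested_profile_even supp])
  have "((\<lambda>\<epsilon>. \<i> / (4 * of_real (Phi \<phi>)) * (jump_sign b k * I (crit k + s * \<epsilon>) (crit k) +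
      (jump_sign b (3 - k) * I (crit k + s * \<epsilon>) (crit (3 - k)) - I (crit k + s * \<epsilon>) \<alpha> + I (crit k + s * \<epsilon>) (2 * pi + \<alpha>))))
    \<longlongrightarrow> one_sided_trace \<rho> k s \<psi>) (at_right 0)"
    unfolding one_sided_trace_def regular_part_def Let_def I_def[symmetric]
    by (intro tendsto_mult tendsto_add tendsto_diff tendsto_const sing reg) auto
  then show "((\<lambda>\<epsilon>. regular_distribution (diffracted_wave b \<phi> \<alpha> F \<rho> (crit k + s * \<epsilon>)) \<psi>)
      \<longlongrightarrow> one_sided_trace \<rho> k s \<psi>) (at_right 0)"
  proof (rule Lim_transform_eventually)
    show "\<forall>\<^sub>F \<epsilon> in at_right 0. \<i> / (4 * of_real (Phi \<phi>)) * (jump_sign b k * I (crit k + s * \<epsilon>) (crit k) +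
      (jump_sign b (3 - k) * I (crit k + s * \<epsilon>) (crit (3 - k)) - I (crit k + s * \<epsilon>) \<alpha> + I (crit k + s * \<epsilon>) (2 * pi + \<alpha>)))
      = regular_distribution (diffracted_wave b \<phi> \<alpha> F \<rho> (crit k + s * \<epsilon>)) \<psi>"
      using critical_angle_neighbourhood[OF k s]
      by eventually_elim (simp only: regular_distribution_diffracted_wave[OF assms(1) _ \<psi>] split)
  qed
qed

text \<open>The regular part is common to both sides and cancels in the difference. At \<beta> = 0
  the delay is \<rho> cosh 0 = \<rho>, so \<open>tested_profile\<close> there is the profile delayed
  by \<rho> and tested against \<psi>.\<close>

lemma jump_distribution_eq:
  assumes "\<rho> > 0" and k: "k \<in> {1, 2}"
  shows "jump_distribution b \<phi> \<alpha> F k \<rho> (\<lambda>\<psi>. jump_sign b k * (LINT t|lborel. P (t - \<rho>) * \<psi> t))"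
  unfolding jump_distribution_def
proof (intro exI conjI ext)
  show "distribution_tendsto (\<lambda>\<epsilon>. diffracted_wave b \<phi> \<alpha> F \<rho> (crit k + \<epsilon>)) (one_sided_trace \<rho> k 1) (at_right 0)"
    using one_sided_trace[OF assms, of 1] by simp
  show "distribution_tendsto (\<lambda>\<epsilon>. diffracted_wave b \<phi> \<alpha> F \<rho> (crit k - \<epsilon>)) (one_sided_trace \<rho> k (-1)) (at_right 0)"
    using one_sided_trace[OF assms, of "-1"] by simp
  fix \<psi>
  have pq: "pi / q = 2 * Phi \<phi>"
    using \<phi> by (simp add: wedge_q_def Phi_def)
  have "Phi \<phi> \<noteq> 0"
    using \<phi> by (simp add: Phi_def)
  then have "one_sided_trace \<rho> k 1 \<psi> - one_sided_trace \<rho> k (-1) \<psi> = jump_sign b k * tested_profile \<rho> \<psi> 0"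
    unfolding one_sided_trace_def times_divide_eq_right[symmetric] pq by (simp add: field_simps)
  then show "jump_sign b k * (LINT t|lborel. P (t - \<rho>) * \<psi> t) = one_sided_trace \<rho> k 1 \<psi> - one_sided_trace \<rho> k (-1) \<psi>"
    by (simp add: tested_profile_def)
qed

section \<open>Long time behaviour of the jump, in both directions\<close>

lemma jump_tendstoI:
  assumes lim: "(P \<longlongrightarrow> C) at_top" and \<rho>: "\<rho> > 0" and k: "k \<in> {1, 2}"
  shows "jump_tendsto b \<phi> \<alpha> F k \<rho> (jump_sign b k * C)"
  unfolding jump_tendsto_def
proof (intro exI conjI ballI)
  define g where "g t = jump_sign b k * P (t - \<rho>)" for t
  have g[measurable]: "g \<in> borel_measurable borel"
    unfolding g_def by measurable
  show "jump_distribution b \<phi> \<alpha> F k \<rho> (\<lambda>\<psi>. jump_sign b k * (LINT t|lborel. P (t - \<rho>) * \<psi> t))"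
    by (rule jump_distribution_eq[OF \<rho> k])
  show "L1_loc g"
    unfolding L1_loc_def
  proof (intro allI impI)
    fix S :: "real set" assume "compact S"
    then have S[measurable]: "S \<in> sets borel" "emeasure lborel S < \<infinity>" and "bounded S"
      using emeasure_bounded_finite[of S] by (auto simp: compact_imp_bounded compact_imp_closed)
    then obtain A where A: "\<And>t. t \<in> S \<Longrightarrow> \<bar>t\<bar> \<le> A" "A > 0"
      unfolding bounded_pos by auto
    have "integrable lborel (\<lambda>t. indicator S t *\<^sub>R g t)"
    proof (rule integrableI_bounded_set_indicator)
      have "norm (g t) \<le> M * (1 + A) ^ m" if "t \<in> S" for t
        using P_bounded[of "t - \<rho>" A] A(1)[OF that] A(2) \<rho> by (simp add: g_def norm_mult)
      then show "AE t in lborel. t \<in> S \<longrightarrow> norm (g t) \<le> M * (1 + A) ^ m"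
        by simp
    qed (use S in auto)
    then show "g absolutely_integrable_on S"
      unfolding set_integrable_def by (subst integrable_completion) measurable
  qed
  fix \<psi> assume "\<psi> \<in> test_functions"
  then have "continuous_on UNIV \<psi>"
    by (rule test_function_continuous_bounded_support)
  then have [measurable]: "\<psi> \<in> borel_measurable borel"
    by (rule borel_measurable_continuous_onI)
  show "jump_sign b k * (LINT t|lborel. P (t - \<rho>) * \<psi> t) = regular_distribution g \<psi>"
    unfolding regular_distribution_def g_def mult.assoc integral_mult_right_zero[symmetric]
    by (rule integral_completion[symmetric]) measurable
next
  have "filterlim (\<lambda>t. t - \<rho>) at_top at_top"
    using filterlim_tendsto_add_at_top[OF tendsto_const[of "- \<rho>"] filterlim_ident] by simp
  then have "((\<lambda>t. jump_sign b k * P (t - \<rho>)) \<longlongrightarrow> jump_sign b k * C) at_top"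
    by (intro tendsto_intros filterlim_compose[OF lim])
  then show "((\<lambda>t. jump_sign b k * P (t - \<rho>)) \<longlongrightarrow> jump_sign b k * C) ae_at_top"
    by (rule tendsto_mono[rotated]) simp
qed

text \<open>Uniqueness of the traces fixes the action of \<open>g\<close> on test functions. After
  replacing \<open>g\<close> by a Borel function \<open>h\<close>, the fundamental lemma applies to
  the difference of \<open>h\<close> and the explicit density; boundedness of \<open>P\<close> on
  half-lines provides its local integrability.\<close>

lemma jump_density_unique:
  assumes \<rho>: "\<rho> > 0" and k: "k \<in> {1, 2}" and J: "jump_distribution b \<phi> \<alpha> F k \<rho> J"
    and g: "L1_loc g" "\<And>\<psi>. \<psi> \<in> test_functions \<Longrightarrow> J \<psi> = regular_distribution g \<psi>"
  shows "AE t in lebesgue. g t = jump_sign b k * P (t - \<rho>)"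
proof -
  obtain h where h[measurable]: "h \<in> borel_measurable borel" and gh: "AE t in lebesgue. g t = h t"
    using lebesgue_measurable_borel_representative[OF L1_loc_borel_measurable[OF g(1)]] .
  have J_eq: "J \<psi> = jump_sign b k * (LINT t|lborel. P (t - \<rho>) * \<psi> t)" if \<psi>: "\<psi> \<in> test_functions" for \<psi>
    by (rule jump_distribution_unique[OF J jump_distribution_eq[OF \<rho> k] \<psi>])
  have int_h: "set_integrable lborel {- real n..real n} h" for n
  proof -
    have "integrable lebesgue (\<lambda>t. indicator {- real n..real n} t *\<^sub>R g t)"
      using g(1) unfolding L1_loc_def set_integrable_def by blast
    moreover have "AE t in lebesgue. indicator {- real n..real n} t *\<^sub>R g t = indicator {- real n..real n} t *\<^sub>R h t"
      using gh by eventually_elim simp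
    ultimately show ?thesis
      unfolding set_integrable_def by (subst AE_lebesgue_borel_measurable(3)[symmetric]) auto
  qed
  have int_P: "set_integrable lborel {- real n..real n} (\<lambda>t. P (t - \<rho>))" for n
    unfolding set_integrable_def
  proof (rule integrableI_bounded_set_indicator)
    show "AE t in lborel. t \<in> {- real n..real n} \<longrightarrow> norm (P (t - \<rho>)) \<le> M * (1 + real n) ^ m"
      using \<rho> by (intro AE_I2 impI P_bounded) auto
  qed auto
  have "AE t in lborel. h t - jump_sign b k * P (t - \<rho>) = 0"
  proof (rule fundamental_lemma_calculus_of_variations)
    show "set_integrable lborel {- real n..real n} (\<lambda>t. h t - jump_sign b k * P (t - \<rho>))" for n
      by (intro set_integral_diff set_integrable_mult_right int_h int_P)
    fix \<psi> assume \<psi>: "\<psi> \<in> test_functions"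
    obtain A where A: "A > 0" "\<And>t. \<bar>t\<bar> > A \<Longrightarrow> \<psi> t = 0" "continuous_on UNIV \<psi>"
      by (rule test_function_continuous_bounded_support[OF \<psi>]) blast
    obtain L where L: "L \<ge> 0" "\<And>t. norm (\<psi> t) \<le> L"
      using continuous_compact_support_bounded[OF A(3,2)] by blast
    have [measurable]: "\<psi> \<in> borel_measurable borel"
      using A(3) by (rule borel_measurable_continuous_onI)
    obtain n :: nat where n: "A < real n"
      using reals_Archimedean2 by blast
    have int: "integrable lborel (\<lambda>t. f t * \<psi> t)"
      if f: "set_integrable lborel {- real n..real n} f" and [measurable]: "f \<in> borel_measurable borel" for f
    proof (rule Bochner_Integration.integrable_bound)
      show "integrable lborel (\<lambda>t. L *\<^sub>R (indicator {- real n..real n} t *\<^sub>R f t))"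
        using f unfolding set_integrable_def by (rule integrable_scaleR_right)
      have "norm (f t * \<psi> t) \<le> norm (L *\<^sub>R (indicator {- real n..real n} t *\<^sub>R f t))" for t
        using L A(2)[of t] n
        by (cases "\<bar>t\<bar> > A") (auto simp: norm_mult mult.commute[of "norm (f _)"] indicator_def intro!: mult_right_mono)
      then show "AE t in lborel. norm (f t * \<psi> t) \<le> norm (L *\<^sub>R (indicator {- real n..real n} t *\<^sub>R f t))"
        by simp
    qed measurable
    have "AE t in lebesgue. g t * \<psi> t = h t * \<psi> t"
      using gh by eventually_elim simp
    then have "(LINT t|lborel. h t * \<psi> t) = regular_distribution g \<psi>"
      unfolding regular_distribution_def by (rule AE_lebesgue_borel_measurable(2)[symmetric]) measurable
    also have "\<dots> = (LINT t|lborel. jump_sign b k * (P (t - \<rho>) * \<psi> t))"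
      using g(2)[OF \<psi>] J_eq[OF \<psi>] by (simp only: integral_mult_right_zero)
    finally show "(LINT t|lborel. (h t - jump_sign b k * P (t - \<rho>)) * \<psi> t) = 0"
      unfolding left_diff_distrib mult.assoc
      using int[OF int_h h] integrable_mult_right[OF int[OF int_P], of "jump_sign b k"]
      by (subst Bochner_Integration.integral_diff) simp_all
  qed measurable
  then have "AE t in lebesgue. h t - jump_sign b k * P (t - \<rho>) = 0"
    by (rule AE_completion)
  with gh show ?thesis
    by eventually_elim simp
qed

lemma jump_tendstoD:
  assumes \<rho>: "\<rho> > 0" and k: "k \<in> {1, 2}" and jump: "jump_tendsto b \<phi> \<alpha> F k \<rho> (jump_sign b k * C)"
  shows "(F \<longlongrightarrow> C) ae_at_top"
  unfolding tendsto_ae_at_top_iff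
proof (intro allI impI)
  obtain J g where J: "jump_distribution b \<phi> \<alpha> F k \<rho> J" and g: "L1_loc g"
      "\<forall>\<psi>\<in>test_functions. J \<psi> = regular_distribution g \<psi>"
    and lim: "(g \<longlongrightarrow> jump_sign b k * C) ae_at_top"
    using jump unfolding jump_tendsto_def by blast
  fix e :: real assume "e > 0"
  then obtain T where "AE t in lebesgue. T \<le> t \<longrightarrow> dist (g t) (jump_sign b k * C) < e"
    using lim unfolding tendsto_ae_at_top_iff by blast
  moreover have "AE t in lebesgue. g t = jump_sign b k * P (t - \<rho>)"
    using g by (intro jump_density_unique[OF \<rho> k J]) auto
  \<comment> \<open>The sign has modulus 1, so multiplication by it is an isometry and can be undone
    in the estimate.\<close>
  moreover have "dist (jump_sign b k * z) (jump_sign b k * C) = dist z C" for z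
    by (simp add: dist_norm norm_mult flip: right_diff_distrib)
  ultimately have "AE t in lebesgue. T \<le> t \<longrightarrow> dist (P (t - \<rho>)) C < e"
    by (auto elim!: eventually_elim2)
  \<comment> \<open>Undoing the delay lowers the threshold from \<open>T\<close> to
    \<open>T - \<rho>\<close>.\<close>
  from AE_lebesgue_shift[OF this, of "- \<rho>"] F_eq_P
  have "AE s in lebesgue. T - \<rho> \<le> s \<longrightarrow> dist (F s) C < e"
    by eventually_elim (auto simp: algebra_simps)
  then show "\<exists>T. AE s in lebesgue. T \<le> s \<longrightarrow> dist (F s) C < e" ..
qed

end

theorem theorem4p2:
  fixes b :: boundary_type and \<phi> \<alpha> p :: real and F :: "real \<Rightarrow> complex" and C :: complex
  assumes "0 < \<phi>" and "\<phi> < pi"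
    and "max 0 (\<phi> - pi / 2) < \<alpha>" and "\<alpha> < min (pi / 2) \<phi>"
    and "L1_loc F"
    and "AE s in lebesgue. s < 0 \<longrightarrow> F s = 0"
    and "\<exists>M. AE s in lebesgue. (1 + \<bar>s\<bar>) powr p * norm (F s) \<le> M"
  shows
    "((F \<longlongrightarrow> C) ae_at_top \<longrightarrow>
        (\<forall>\<rho>>0. \<forall>\<theta>\<in>regular_angles \<phi> \<alpha>.
           ((\<lambda>t. diffracted_wave b \<phi> \<alpha> F \<rho> \<theta> t) \<longlongrightarrow> diffracted_wave_limit b \<phi> \<alpha> C \<theta>) at_top) \<and>
        (\<forall>\<rho>>0. \<forall>k\<in>{1, 2}. jump_tendsto b \<phi> \<alpha> F k \<rho> (jump_sign b k * C)))
     \<and>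
     ((\<forall>\<rho>>0. \<forall>k\<in>{1, 2}. jump_tendsto b \<phi> \<alpha> F k \<rho> (jump_sign b k * C)) \<longrightarrow>
        (F \<longlongrightarrow> C) ae_at_top)"
proof -
  obtain P M m where P: "P \<in> borel_measurable borel" "AE s in lebesgue. F s = P s"
      "\<And>s. s < 0 \<Longrightarrow> P s = 0" "\<And>s. norm (P s) \<le> M * (1 + \<bar>s\<bar>) ^ m"
    and lim: "(F \<longlongrightarrow> C) ae_at_top \<Longrightarrow> (P \<longlongrightarrow> C) at_top"
    by (rule profile_representative[OF assms(5-7), where C = C]) blast
  interpret wedge_profile b \<phi> \<alpha> F P M m
    by unfold_locales (use assms P in auto)
  show ?thesis
  proof (intro conjI impI allI ballI)
    assume "\<forall>\<rho>>0. \<forall>k\<in>{1, 2}. jump_tendsto b \<phi> \<alpha> F k \<rho> (jump_sign b k * C)"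
    then show "(F \<longlongrightarrow> C) ae_at_top"
      using jump_tendstoD[of 1 1 C] by simp
  qed (use diffracted_wave_tendsto jump_tendstoI lim in auto)
qed

end
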